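(* Let $\mathbb{K}$ be a field and let $P$ be a finite partially ordered set. (1) If $X$ is a finite filtered CW-complex over $P$, then its zero-dimensional homology $H_0(X;\mathbb{K})$, i.e. the functor $q\mapsto H_0(X(q);\mathbb{K})$, is a finitely generated component module over $P$. (2) Every finitely generated component module over $P$ is isomorphic to $H_0(X;\mathbb{K})$ for some finite filtered CW-complex $X$ over $P$.
   Context: A partially ordered set $P$ is viewed as a category with one object for each element and a unique morphism $p\to q$ whenever $p\le q$. A persistence module over $P$ is a functor from $P$ to the category of finite-dimensional $\mathbb{K}$-vector spaces and linear maps. A filtered CW-complex over $P$ is a functor $X$ from $P$ to the category of CW-complexes and inclusions of subcomplexes; it is finite if each $X(q)$, $q\in P$, is a finite CW-complex. A persistence module $M$ over $P$ is a component module if there is a choice of basis of every vector space $M(q)$, $q\in P$ (together called a component basis of $M$), such that for every morphism $\alpha\colon q\to p$ in $P$ the matrix of $M(\alpha)$ with respect to these bases contains only zeros and ones, with exactly one $1$ in each column. An element of the component basis in $M(q)$ is called a generator if it is not in the image of $M(\alpha)$ for any non-identity morphism $\alpha\colon p\to q$ in $P$. The module is finitely generated if it has finitely many generators. *)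

theory Defs
  imports "HOL-Homology.Homology" "Jordan_Normal_Form.Missing_VectorSpace"
begin

section \<open>Persistence modules\<close>

text \<open>
  A poset is a set \<open>P\<close> of elements of an ordered type, with the induced order (so \<open>P\<close> may be empty).
  \<open>pm_mor M q p\<close> is the map \<open>M(q) \<rightarrow> M(p)\<close> of the morphism \<open>q \<le> p\<close>. Values outside \<open>P\<close>, or for
  pairs that are not comparable, are irrelevant.
\<close>

record ('p, 'k, 'v) pers_module =
  pm_obj :: "'p \<Rightarrow> ('k, 'v) module"
  pm_mor :: "'p \<Rightarrow> 'p \<Rightarrow> 'v \<Rightarrow> 'v"

definition persistence_module ::
    "('k, 'm) ring_scheme \<Rightarrow> 'p::order set \<Rightarrow> ('p, 'k, 'v) pers_module \<Rightarrow> bool" where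
  "persistence_module K P M \<longleftrightarrow>
     (\<forall>q\<in>P. vectorspace K (pm_obj M q) \<and> vectorspace.fin_dim K (pm_obj M q)) \<and>
     (\<forall>q\<in>P. \<forall>p\<in>P. q \<le> p \<longrightarrow> linear_map K (pm_obj M q) (pm_obj M p) (pm_mor M q p)) \<and>
     (\<forall>q\<in>P. \<forall>v\<in>carrier (pm_obj M q). pm_mor M q q v = v) \<and>
     (\<forall>q\<in>P. \<forall>p\<in>P. \<forall>r\<in>P. q \<le> p \<longrightarrow> p \<le> r \<longrightarrow>
        (\<forall>v\<in>carrier (pm_obj M q). pm_mor M q r v = pm_mor M p r (pm_mor M q p v)))"

definition persistence_iso ::
    "('k, 'm) ring_scheme \<Rightarrow> 'p::order set \<Rightarrow>
     ('p, 'k, 'v) pers_module \<Rightarrow> ('p, 'k, 'w) pers_module \<Rightarrow> bool" where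
  "persistence_iso K P M N \<longleftrightarrow>
     (\<exists>\<phi>. (\<forall>q\<in>P. linear_map K (pm_obj M q) (pm_obj N q) (\<phi> q) \<and>
                bij_betw (\<phi> q) (carrier (pm_obj M q)) (carrier (pm_obj N q))) \<and>
          (\<forall>q\<in>P. \<forall>p\<in>P. q \<le> p \<longrightarrow>
             (\<forall>v\<in>carrier (pm_obj M q). \<phi> p (pm_mor M q p v) = pm_mor N q p (\<phi> q v))))"


section \<open>Component modules\<close>

text \<open>The coordinates of \<open>v\<close> with respect to a finite basis \<open>B\<close> of \<open>V\<close>.\<close>

definition basis_coord ::
    "('k, 'm) ring_scheme \<Rightarrow> ('k, 'v) module \<Rightarrow> 'v set \<Rightarrow> 'v \<Rightarrow> 'v \<Rightarrow> 'k" where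
  "basis_coord K V B v = (THE a. a \<in> B \<rightarrow>\<^sub>E carrier K \<and> module.lincomb V a B = v)"

text \<open>The matrix of \<open>T : V \<rightarrow> W\<close>; only \<open>W\<close> and its basis \<open>C\<close> enter the entry at row \<open>c \<in> C\<close>
  and column \<open>b\<close>, where \<open>b\<close> is an element of the chosen basis of \<open>V\<close>.\<close>

definition matrix_entry ::
    "('k, 'm) ring_scheme \<Rightarrow> ('k, 'w) module \<Rightarrow> 'w set \<Rightarrow> ('v \<Rightarrow> 'w) \<Rightarrow> 'w \<Rightarrow> 'v \<Rightarrow> 'k" where
  "matrix_entry K W C T c b = basis_coord K W C (T b) c"

definition component_basis ::
    "('k, 'm) ring_scheme \<Rightarrow> 'p::order set \<Rightarrow> ('p, 'k, 'v) pers_module \<Rightarrow> ('p \<Rightarrow> 'v set) \<Rightarrow> bool" where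
  "component_basis K P M B \<longleftrightarrow>
     (\<forall>q\<in>P. vectorspace.basis K (pm_obj M q) (B q)) \<and>
     (\<forall>q\<in>P. \<forall>p\<in>P. q \<le> p \<longrightarrow>
        (\<forall>b\<in>B q.
           (\<forall>c\<in>B p. matrix_entry K (pm_obj M p) (B p) (pm_mor M q p) c b \<in> {\<zero>\<^bsub>K\<^esub>, \<one>\<^bsub>K\<^esub>}) \<and>
           (\<exists>!c. c \<in> B p \<and> matrix_entry K (pm_obj M p) (B p) (pm_mor M q p) c b = \<one>\<^bsub>K\<^esub>)))"

definition component_module ::
    "('k, 'm) ring_scheme \<Rightarrow> 'p::order set \<Rightarrow> ('p, 'k, 'v) pers_module \<Rightarrow> bool" where
  "component_module K P M \<longleftrightarrow> persistence_module K P M \<and> (\<exists>B. component_basis K P M B)"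

text \<open>Generators are tagged with their position in \<open>P\<close>, since the spaces \<open>M(q)\<close> may overlap as sets.\<close>

definition generators ::
    "'p::order set \<Rightarrow> ('p, 'k, 'v) pers_module \<Rightarrow> ('p \<Rightarrow> 'v set) \<Rightarrow> ('p \<times> 'v) set" where
  "generators P M B =
     {(q, b). q \<in> P \<and> b \<in> B q \<and> (\<forall>p\<in>P. p < q \<longrightarrow> b \<notin> pm_mor M p q ` carrier (pm_obj M p))}"

definition fin_gen_component_module ::
    "('k, 'm) ring_scheme \<Rightarrow> 'p::order set \<Rightarrow> ('p, 'k, 'v) pers_module \<Rightarrow> bool" where
  "fin_gen_component_module K P M \<longleftrightarrow>
     component_module K P M \<and> (\<exists>B. component_basis K P M B \<and> finite (generators P M B))"


section \<open>Filtered CW-complexes\<close>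

definition cw_disk :: "nat \<Rightarrow> (nat \<Rightarrow> real) topology" where
  "cw_disk n = subtopology (Euclidean_space n) {x. (\<Sum>i<n. x i ^ 2) \<le> 1}"

definition cw_disk_interior :: "nat \<Rightarrow> (nat \<Rightarrow> real) set" where
  "cw_disk_interior n = {x \<in> topspace (cw_disk n). (\<Sum>i<n. x i ^ 2) < 1}"

definition cw_disk_boundary :: "nat \<Rightarrow> (nat \<Rightarrow> real) set" where
  "cw_disk_boundary n = {x \<in> topspace (cw_disk n). (\<Sum>i<n. x i ^ 2) = 1}"

text \<open>\<open>(n, e) \<in> cw_cells X\<close> means that \<open>e\<close> is an open cell of dimension \<open>n\<close>.\<close>

record 'a cw_data =
  cw_top :: "'a topology"
  cw_cells :: "(nat \<times> 'a set) set"

definition characteristic_map :: "'a cw_data \<Rightarrow> nat \<Rightarrow> 'a set \<Rightarrow> ((nat \<Rightarrow> real) \<Rightarrow> 'a) \<Rightarrow> bool" where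
  "characteristic_map X n e \<Phi> \<longleftrightarrow>
     continuous_map (cw_disk n) (cw_top X) \<Phi> \<and>
     homeomorphic_map (subtopology (cw_disk n) (cw_disk_interior n)) (subtopology (cw_top X) e) \<Phi> \<and>
     (\<exists>F. finite F \<and> F \<subseteq> {(m, d) \<in> cw_cells X. m < n} \<and>
          \<Phi> ` cw_disk_boundary n \<subseteq> \<Union>(snd ` F))"

text \<open>The definition of Whitehead: a Hausdorff space partitioned into cells with characteristic maps,
  closure-finite and carrying the weak topology with respect to the closed cells.\<close>

definition cw_complex :: "'a cw_data \<Rightarrow> bool" where
  "cw_complex X \<longleftrightarrow>
     Hausdorff_space (cw_top X) \<and>
     \<Union>(snd ` cw_cells X) = topspace (cw_top X) \<and>
     (\<forall>(m, d)\<in>cw_cells X. \<forall>(n, e)\<in>cw_cells X. (m, d) \<noteq> (n, e) \<longrightarrow> d \<inter> e = {}) \<and>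
     (\<forall>(n, e)\<in>cw_cells X. \<exists>\<Phi>. characteristic_map X n e \<Phi>) \<and>
     (\<forall>A \<subseteq> topspace (cw_top X).
        closedin (cw_top X) A \<longleftrightarrow>
        (\<forall>(n, e)\<in>cw_cells X. closedin (cw_top X) (A \<inter> (cw_top X closure_of e))))"

definition finite_cw_complex :: "'a cw_data \<Rightarrow> bool" where
  "finite_cw_complex X \<longleftrightarrow> cw_complex X \<and> finite (cw_cells X)"

definition cw_subcomplex :: "'a cw_data \<Rightarrow> 'a cw_data \<Rightarrow> bool" where
  "cw_subcomplex A X \<longleftrightarrow>
     cw_cells A \<subseteq> cw_cells X \<and>
     cw_top A = subtopology (cw_top X) (\<Union>(snd ` cw_cells A)) \<and>
     (\<forall>(n, e)\<in>cw_cells A. (cw_top X closure_of e) \<subseteq> \<Union>(snd ` cw_cells A))"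

text \<open>The morphism \<open>q \<le> p\<close> is sent to the inclusion of \<open>X(q)\<close> in \<open>X(p)\<close>, so that
  functoriality is automatic.\<close>

definition filtered_cw_complex :: "'p::order set \<Rightarrow> ('p \<Rightarrow> 'a cw_data) \<Rightarrow> bool" where
  "filtered_cw_complex P X \<longleftrightarrow>
     (\<forall>q\<in>P. cw_complex (X q)) \<and>
     (\<forall>q\<in>P. \<forall>p\<in>P. q \<le> p \<longrightarrow> cw_subcomplex (X q) (X p))"

definition finite_filtered_cw_complex :: "'p::order set \<Rightarrow> ('p \<Rightarrow> 'a cw_data) \<Rightarrow> bool" where
  "finite_filtered_cw_complex P X \<longleftrightarrow>
     filtered_cw_complex P X \<and> (\<forall>q\<in>P. finite_cw_complex (X q))"


section \<open>Singular homology with coefficients in a field\<close>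

text \<open>
  The library has integral singular homology only. Over \<open>K\<close>, a singular \<open>p\<close>-chain of \<open>T\<close> is a
  finitely supported function from singular \<open>p\<close>-simplices to \<open>carrier K\<close>. The simplices, their faces
  and their images under maps are those of the library, and so is the convention that the boundary of a
  \<open>0\<close>-chain is \<open>0\<close>. The fields \<open>mult\<close> and \<open>one\<close> of a module record play no role.
\<close>

type_synonym ('k, 'a) K_chain = "((nat \<Rightarrow> real) \<Rightarrow> 'a) \<Rightarrow> 'k"

definition chain_space ::
    "('k, 'm) ring_scheme \<Rightarrow> nat \<Rightarrow> 'a topology \<Rightarrow> ('k, ('k, 'a) K_chain) module" where
  "chain_space K p T =
     \<lparr>carrier = {c. finite {f. c f \<noteq> \<zero>\<^bsub>K\<^esub>} \<and> (\<forall>f. c f \<in> carrier K) \<and>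
                    (\<forall>f. c f \<noteq> \<zero>\<^bsub>K\<^esub> \<longrightarrow> singular_simplex p T f)},
      mult = undefined,
      one = undefined,
      zero = (\<lambda>f. \<zero>\<^bsub>K\<^esub>),
      add = (\<lambda>c d f. c f \<oplus>\<^bsub>K\<^esub> d f),
      smult = (\<lambda>a c f. a \<otimes>\<^bsub>K\<^esub> c f)\<rparr>"

text \<open>The linear extension of \<open>f \<mapsto> \<Sum>k\<le>p. (-1)^k * (k-th face of f)\<close>, as a coefficient function.\<close>

definition K_boundary ::
    "('k, 'm) ring_scheme \<Rightarrow> nat \<Rightarrow> ('k, 'a) K_chain \<Rightarrow> ('k, 'a) K_chain" where
  "K_boundary K p c = (\<lambda>g. if p = 0 then \<zero>\<^bsub>K\<^esub> else
     (\<Oplus>\<^bsub>K\<^esub> f \<in> {f. c f \<noteq> \<zero>\<^bsub>K\<^esub>}. \<Oplus>\<^bsub>K\<^esub> k \<in> {k. k \<le> p \<and> singular_face p k f = g}.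
        ((\<ominus>\<^bsub>K\<^esub> \<one>\<^bsub>K\<^esub>) [^]\<^bsub>K\<^esub> k) \<otimes>\<^bsub>K\<^esub> c f))"

definition K_chain_map ::
    "('k, 'm) ring_scheme \<Rightarrow> nat \<Rightarrow> ('a \<Rightarrow> 'b) \<Rightarrow> ('k, 'a) K_chain \<Rightarrow> ('k, 'b) K_chain" where
  "K_chain_map K p h c = (\<lambda>g. \<Oplus>\<^bsub>K\<^esub> f \<in> {f. c f \<noteq> \<zero>\<^bsub>K\<^esub> \<and> simplex_map p h f = g}. c f)"

definition K_cycles ::
    "('k, 'm) ring_scheme \<Rightarrow> nat \<Rightarrow> 'a topology \<Rightarrow> ('k, 'a) K_chain set" where
  "K_cycles K p T = {c \<in> carrier (chain_space K p T). K_boundary K p c = (\<lambda>f. \<zero>\<^bsub>K\<^esub>)}"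

definition K_boundaries ::
    "('k, 'm) ring_scheme \<Rightarrow> nat \<Rightarrow> 'a topology \<Rightarrow> ('k, 'a) K_chain set" where
  "K_boundaries K p T = K_boundary K (Suc p) ` carrier (chain_space K (Suc p) T)"

text \<open>The quotient \<open>Z / B\<close> of submodules \<open>B \<subseteq> Z\<close> of \<open>V\<close>, as a module of cosets. Adding \<open>B\<close> in the scalar
  multiplication makes \<open>0\<close> times a coset equal to the coset \<open>B\<close>.\<close>

definition coset_module :: "('k, 'v) module \<Rightarrow> 'v set \<Rightarrow> 'v set \<Rightarrow> ('k, 'v set) module" where
  "coset_module V Z B =
     \<lparr>carrier = (\<lambda>z. B +>\<^bsub>V\<^esub> z) ` Z,
      mult = undefined,
      one = undefined,
      zero = B,
      add = (\<lambda>S S'. S <+>\<^bsub>V\<^esub> S'),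
      smult = (\<lambda>a S. B <+>\<^bsub>V\<^esub> ((\<lambda>s. a \<odot>\<^bsub>V\<^esub> s) ` S))\<rparr>"

definition K_homology ::
    "('k, 'm) ring_scheme \<Rightarrow> nat \<Rightarrow> 'a topology \<Rightarrow> ('k, ('k, 'a) K_chain set) module" where
  "K_homology K p T = coset_module (chain_space K p T) (K_cycles K p T) (K_boundaries K p T)"

text \<open>The map induced by \<open>h : T \<rightarrow> T'\<close>; it sends the class of \<open>z\<close> to the class of \<open>K_chain_map K p h z\<close>.\<close>

definition K_hom_induced ::
    "('k, 'm) ring_scheme \<Rightarrow> nat \<Rightarrow> 'b topology \<Rightarrow> ('a \<Rightarrow> 'b) \<Rightarrow>
     ('k, 'a) K_chain set \<Rightarrow> ('k, 'b) K_chain set" where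
  "K_hom_induced K p T' h S =
     K_boundaries K p T' <+>\<^bsub>chain_space K p T'\<^esub> (K_chain_map K p h ` S)"

definition homology_pers_module ::
    "('k, 'm) ring_scheme \<Rightarrow> nat \<Rightarrow> ('p \<Rightarrow> 'a cw_data) \<Rightarrow> ('p, 'k, ('k, 'a) K_chain set) pers_module" where
  "homology_pers_module K n X =
     \<lparr>pm_obj = (\<lambda>q. K_homology K n (cw_top (X q))),
      pm_mor = (\<lambda>q p. K_hom_induced K n (cw_top (X p)) (\<lambda>x. x))\<rparr>"

end

theory Submission
  imports Defs
begin

text \<open>
  Both directions rest on one description of zero-dimensional homology, for a space \<open>T\<close> with finitely many
  path components: the classes of the points of \<open>T\<close> form a basis of \<open>H\<^sub>0(T; K)\<close>, two points have the same
  class exactly when a path joins them, and an inclusion of spaces sends the class of a point to the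
  class of the same point. To see this, choose a base point in every path component and let \<open>\<rho>\<close> be the
  endomorphism of the space of 0-chains that moves every point to the base point of its component. The two ends of a 1-simplex lie in one component, so \<open>\<rho>\<close>
  kills boundaries. Conversely, a choice of a path from every point to its base point turns a 0-chain \<open>d\<close>
  into a 1-chain with boundary \<open>d - \<rho> d\<close>, so every chain killed by \<open>\<rho>\<close> is a boundary
  (\<open>K_boundaries_0\<close>). Hence \<open>H\<^sub>0\<close> is the quotient by the kernel of \<open>\<rho>\<close>, and the class of a chain is
  determined by its image under \<open>\<rho>\<close>, a combination of base points (\<open>basis_point_class\<close>).

  On the algebraic side, a column of a matrix contains only zeros and ones, with exactly one 1, if and
  only if the map sends the corresponding basis element to a basis element. Thus a component basis is
  the same as a family of bases that the maps of the persistence module carry into one another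
  (\<open>component_basis_iff\<close>).

  For part (1), take the classes of points as the bases. They are finite in number because every cell
  is path connected, so all of its points share one class.

  For part (2), let \<open>B\<close> be a component basis of \<open>M\<close>. The space \<open>X(q)\<close> is the graph with a vertex for every
  pair of some \<open>p \<le> q\<close> and some \<open>b \<in> B p\<close>, and with an edge from \<open>(p, b)\<close> to \<open>(r, M(p \<le> r) b)\<close> for all
  \<open>p < r \<le> q\<close>. Every vertex \<open>(p, b)\<close> of \<open>X(q)\<close> is joined to \<open>(q, M(p \<le> q) b)\<close>, and the label
  \<open>M(p \<le> q) b\<close> is constant along edges by functoriality, so the components of \<open>X(q)\<close> correspond to the
  elements of \<open>B q\<close>. The graphs form a filtration, and the bijections of bases extend linearly to an
  isomorphism. It is natural because the vertices \<open>(q, b)\<close> and \<open>(p, M(q \<le> p) b)\<close> are joined in \<open>X(p)\<close>.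
\<close>

section \<open>Bases and linear maps\<close>

lemma linear_mapI:
  assumes "vectorspace K V" "vectorspace K W" "f \<in> carrier V \<rightarrow> carrier W"
    and "\<And>v w. v \<in> carrier V \<Longrightarrow> w \<in> carrier V \<Longrightarrow> f (v \<oplus>\<^bsub>V\<^esub> w) = f v \<oplus>\<^bsub>W\<^esub> f w"
    and "\<And>a v. a \<in> carrier K \<Longrightarrow> v \<in> carrier V \<Longrightarrow> f (a \<odot>\<^bsub>V\<^esub> v) = a \<odot>\<^bsub>W\<^esub> f v"
  shows "linear_map K V W f"
  using assms unfolding linear_map_def mod_hom_def mod_hom_axioms_def module_hom_def vectorspace_def
  by auto

lemma linear_map_comp:
  assumes "linear_map K U V f" "linear_map K V W g"
  shows "linear_map K U W (\<lambda>u. g (f u))"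
proof -
  interpret f: linear_map K U V f by fact
  interpret g: linear_map K V W g by fact
  show ?thesis
    by (rule linear_mapI) (auto intro: f.V.vectorspace_axioms g.W.vectorspace_axioms)
qed

lemma linear_map_finsum:
  assumes "linear_map K V W f" "g \<in> A \<rightarrow> carrier V"
  shows "f (\<Oplus>\<^bsub>V\<^esub>i\<in>A. g i) = (\<Oplus>\<^bsub>W\<^esub>i\<in>A. f (g i))"
proof -
  interpret f: linear_map K V W f by fact
  show ?thesis using assms(2)
  proof (induction A rule: infinite_finite_induct)
    case (insert a A)
    then have "(\<lambda>i. f (g i)) \<in> A \<rightarrow> carrier W" "g \<in> A \<rightarrow> carrier V" "g a \<in> carrier V" by auto
    then show ?case using insert by simp
  qed auto
qed

lemma linear_map_lincomb:
  assumes "linear_map K V W f" "B \<subseteq> carrier V" "a \<in> B \<rightarrow> carrier K"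
  shows "f (module.lincomb V a B) = (\<Oplus>\<^bsub>W\<^esub>b\<in>B. a b \<odot>\<^bsub>W\<^esub> f b)"
proof -
  interpret f: linear_map K V W f by fact
  have "f (module.lincomb V a B) = (\<Oplus>\<^bsub>W\<^esub>b\<in>B. f (a b \<odot>\<^bsub>V\<^esub> b))"
    unfolding f.V.module.lincomb_def by (rule linear_map_finsum) (use assms in auto)
  also have "\<dots> = (\<Oplus>\<^bsub>W\<^esub>b\<in>B. a b \<odot>\<^bsub>W\<^esub> f b)"
    by (rule f.W.module.M.finsum_cong') (use assms in \<open>auto simp: Pi_iff subset_iff\<close>)
  finally show ?thesis .
qed

lemma (in vectorspace) basis_subset_carrier: "basis B \<Longrightarrow> B \<subseteq> carrier V"
  by (simp add: basis_def)

context
  fixes K :: "('k, 'm) ring_scheme" and V :: "('k, 'v) module"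
  assumes V: "vectorspace K V"
begin

interpretation vectorspace K V by (fact V)

lemma basis_coord:
  assumes "finite B" "basis B" "v \<in> carrier V"
  shows "basis_coord K V B v \<in> B \<rightarrow>\<^sub>E carrier K" "lincomb (basis_coord K V B v) B = v"
proof -
  have "\<exists>!a. a \<in> B \<rightarrow>\<^sub>E carrier K \<and> lincomb a B = v"
    using assms basis_criterion[OF assms(1)] basis_subset_carrier by blast
  from theI'[OF this] show "basis_coord K V B v \<in> B \<rightarrow>\<^sub>E carrier K" "lincomb (basis_coord K V B v) B = v"
    unfolding basis_coord_def by auto
qed

lemma basis_coord_eqI:
  assumes B: "finite B" "basis B" and a: "a \<in> B \<rightarrow> carrier K" "lincomb a B = v" and b: "b \<in> B"
  shows "basis_coord K V B v b = a b"
proof -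
  have BV: "B \<subseteq> carrier V" using B basis_subset_carrier by blast
  have v: "v \<in> carrier V" using a BV by blast
  have 1: "restrict a B \<in> B \<rightarrow>\<^sub>E carrier K" using a by auto
  have 2: "lincomb (restrict a B) B = v"
    using a BV by (subst lincomb_cong[OF refl BV, of _ a]) auto
  have "\<exists>!a. a \<in> B \<rightarrow>\<^sub>E carrier K \<and> lincomb a B = v"
    using v B basis_criterion[OF B(1) BV] by blast
  then have "basis_coord K V B v = restrict a B"
    using 1 2 basis_coord[OF B v] by blast
  then show ?thesis using b by simp
qed

lemma lincomb_indicator:
  assumes "finite B" "B \<subseteq> carrier V" "c \<in> B"
  shows "lincomb (\<lambda>b. if b = c then \<one>\<^bsub>K\<^esub> else \<zero>\<^bsub>K\<^esub>) B = c"
proof -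
  have "lincomb (\<lambda>b. if b = c then \<one>\<^bsub>K\<^esub> else \<zero>\<^bsub>K\<^esub>) B = (\<Oplus>\<^bsub>V\<^esub>b\<in>B. if b = c then b else \<zero>\<^bsub>V\<^esub>)"
    unfolding lincomb_def using assms by (intro finsum_cong') auto
  also have "\<dots> = c"
    using assms by (intro M.add.finprod_singleton_swap) auto
  finally show ?thesis .
qed

text \<open>
  A vector whose coordinates are zeros and a single 1 is the linear combination that picks out one basis
  element. This translates the matrix condition on component bases into a condition on images.
\<close>

lemma zero_one_column_iff:
  assumes B: "finite B" "basis B" and v: "v \<in> carrier V"
  shows "(\<forall>c\<in>B. basis_coord K V B v c \<in> {\<zero>\<^bsub>K\<^esub>, \<one>\<^bsub>K\<^esub>}) \<and>
         (\<exists>!c. c \<in> B \<and> basis_coord K V B v c = \<one>\<^bsub>K\<^esub>) \<longleftrightarrow> v \<in> B"  (is "?L \<longleftrightarrow> _")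
proof
  have BV: "B \<subseteq> carrier V" using B basis_subset_carrier by blast
  assume ?L
  then obtain c where c: "c \<in> B" "\<And>b. b \<in> B \<Longrightarrow> basis_coord K V B v b = (if b = c then \<one>\<^bsub>K\<^esub> else \<zero>\<^bsub>K\<^esub>)"
    by (metis insert_iff singletonD)
  have "v = lincomb (basis_coord K V B v) B" using basis_coord[OF B v] by simp
  also have "\<dots> = lincomb (\<lambda>b. if b = c then \<one>\<^bsub>K\<^esub> else \<zero>\<^bsub>K\<^esub>) B"
    by (rule lincomb_cong) (use c BV in auto)
  also have "\<dots> = c" using lincomb_indicator[OF B(1) BV c(1)] .
  finally show "v \<in> B" using c by simp
next
  have BV: "B \<subseteq> carrier V" using B basis_subset_carrier by blast
  assume vB: "v \<in> B"
  have "basis_coord K V B v b = (if b = v then \<one>\<^bsub>K\<^esub> else \<zero>\<^bsub>K\<^esub>)" if "b \<in> B" for b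
    using basis_coord_eqI[OF B _ lincomb_indicator[OF B(1) BV vB] that] by auto
  then show ?L using vB zero_not_one by (auto split: if_splits)
qed

lemma basis_coord_add:
  assumes B: "finite B" "basis B" and v: "v \<in> carrier V" and w: "w \<in> carrier V" and b: "b \<in> B"
  shows "basis_coord K V B (v \<oplus>\<^bsub>V\<^esub> w) b = basis_coord K V B v b \<oplus>\<^bsub>K\<^esub> basis_coord K V B w b"
proof -
  have BV: "B \<subseteq> carrier V" using B basis_subset_carrier by blast
  note cv = basis_coord[OF B v] and cw = basis_coord[OF B w]
  have "lincomb (\<lambda>b. basis_coord K V B v b \<oplus>\<^bsub>K\<^esub> basis_coord K V B w b) B = v \<oplus>\<^bsub>V\<^esub> w"
    using cv cw by (subst lincomb_sum[OF B(1) BV]) auto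
  then show ?thesis using cv cw by (intro basis_coord_eqI[OF B _ _ b]) auto
qed

lemma basis_coord_smult:
  assumes B: "finite B" "basis B" and v: "v \<in> carrier V" and a: "a \<in> carrier K" and b: "b \<in> B"
  shows "basis_coord K V B (a \<odot>\<^bsub>V\<^esub> v) b = a \<otimes>\<^bsub>K\<^esub> basis_coord K V B v b"
proof -
  have BV: "B \<subseteq> carrier V" using B basis_subset_carrier by blast
  note cv = basis_coord[OF B v]
  have "lincomb (\<lambda>b. a \<otimes>\<^bsub>K\<^esub> basis_coord K V B v b) B = a \<odot>\<^bsub>V\<^esub> v"
    using cv a by (subst lincomb_smult[OF BV]) auto
  then show ?thesis using cv a by (intro basis_coord_eqI[OF B _ _ b]) auto
qed

end

lemma linear_maps_eq_on_basis:
  fixes V :: "('k, 'v) module"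
  assumes f: "linear_map K V W f" and g: "linear_map K V W g"
    and B: "finite B" "vectorspace.basis K V B"
    and eq: "\<And>b. b \<in> B \<Longrightarrow> f b = g b" and v: "v \<in> carrier V"
  shows "f v = g v"
proof -
  interpret f: linear_map K V W f by fact
  interpret g: linear_map K V W g by fact
  note c = basis_coord[OF f.V.vectorspace_axioms B v]
  have BV: "B \<subseteq> carrier V" using B f.V.basis_subset_carrier by blast
  have "f v = (\<Oplus>\<^bsub>W\<^esub>b\<in>B. basis_coord K V B v b \<odot>\<^bsub>W\<^esub> f b)"
    using linear_map_lincomb[OF f BV, of "basis_coord K V B v"] c by auto
  also have "\<dots> = (\<Oplus>\<^bsub>W\<^esub>b\<in>B. basis_coord K V B v b \<odot>\<^bsub>W\<^esub> g b)"
    by (rule f.W.module.M.finsum_cong') (use eq c BV in \<open>auto simp: PiE_iff subset_iff\<close>)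
  also have "\<dots> = g v"
    using linear_map_lincomb[OF g BV, of "basis_coord K V B v"] c by (simp add: PiE_def)
  finally show ?thesis .
qed

lemma linear_extension:
  fixes V :: "('k, 'v) module" and W :: "('k, 'w) module"
  assumes V: "vectorspace K V" and W: "vectorspace K W"
    and B: "finite B" "vectorspace.basis K V B" and s: "\<sigma> \<in> B \<rightarrow> carrier W"
  obtains \<phi> where "linear_map K V W \<phi>" "\<And>b. b \<in> B \<Longrightarrow> \<phi> b = \<sigma> b"
proof -
  interpret V: vectorspace K V by fact
  interpret W: vectorspace K W by fact
  have BV: "B \<subseteq> carrier V" using B V.basis_subset_carrier by blast
  define \<phi> where "\<phi> v = (\<Oplus>\<^bsub>W\<^esub>b\<in>B. basis_coord K V B v b \<odot>\<^bsub>W\<^esub> \<sigma> b)" for v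
  have cc: "basis_coord K V B v b \<in> carrier K" if "v \<in> carrier V" "b \<in> B" for v b
    using basis_coord[OF V B that(1)] that(2) by auto
  have lin: "linear_map K V W \<phi>"
  proof (rule linear_mapI[OF V W])
    show "\<phi> \<in> carrier V \<rightarrow> carrier W"
      unfolding \<phi>_def using cc s by (auto intro!: W.finsum_closed)
  next
    fix v w assume v: "v \<in> carrier V" and w: "w \<in> carrier V"
    have "\<phi> (v \<oplus>\<^bsub>V\<^esub> w) = (\<Oplus>\<^bsub>W\<^esub>b\<in>B. basis_coord K V B v b \<odot>\<^bsub>W\<^esub> \<sigma> b \<oplus>\<^bsub>W\<^esub> basis_coord K V B w b \<odot>\<^bsub>W\<^esub> \<sigma> b)"
      unfolding \<phi>_def using cc s v w
      by (intro W.finsum_cong') (auto simp: basis_coord_add[OF V B] W.smult_l_distr Pi_iff)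
    also have "\<dots> = \<phi> v \<oplus>\<^bsub>W\<^esub> \<phi> w"
      unfolding \<phi>_def using cc s v w by (intro W.finsum_addf) auto
    finally show "\<phi> (v \<oplus>\<^bsub>V\<^esub> w) = \<phi> v \<oplus>\<^bsub>W\<^esub> \<phi> w" .
  next
    fix a v assume a: "a \<in> carrier K" and v: "v \<in> carrier V"
    have "\<phi> (a \<odot>\<^bsub>V\<^esub> v) = (\<Oplus>\<^bsub>W\<^esub>b\<in>B. a \<odot>\<^bsub>W\<^esub> (basis_coord K V B v b \<odot>\<^bsub>W\<^esub> \<sigma> b))"
      unfolding \<phi>_def using cc s v a
      by (intro W.finsum_cong') (auto simp: basis_coord_smult[OF V B] W.smult_assoc1 Pi_iff)
    also have "\<dots> = a \<odot>\<^bsub>W\<^esub> \<phi> v"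
      unfolding \<phi>_def using cc s v a B by (intro W.finsum_smult_ldistr[symmetric]) auto
    finally show "\<phi> (a \<odot>\<^bsub>V\<^esub> v) = a \<odot>\<^bsub>W\<^esub> \<phi> v" .
  qed
  have ext: "\<phi> c = \<sigma> c" if c: "c \<in> B" for c
  proof -
    have "\<phi> c = (\<Oplus>\<^bsub>W\<^esub>b\<in>B. if b = c then \<sigma> b else \<zero>\<^bsub>W\<^esub>)"
      unfolding \<phi>_def
    proof (rule W.finsum_cong')
      fix b assume b: "b \<in> B"
      have "basis_coord K V B c b = (if b = c then \<one>\<^bsub>K\<^esub> else \<zero>\<^bsub>K\<^esub>)"
        by (rule basis_coord_eqI[OF V B _ lincomb_indicator[OF V B(1) BV c] b]) auto
      then show "basis_coord K V B c b \<odot>\<^bsub>W\<^esub> \<sigma> b = (if b = c then \<sigma> b else \<zero>\<^bsub>W\<^esub>)"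
        using s b by (auto simp: Pi_iff)
    qed (use s in auto)
    also have "\<dots> = \<sigma> c" using s B c by (intro W.M.add.finprod_singleton_swap) auto
    finally show ?thesis .
  qed
  show thesis using that lin ext by blast
qed

text \<open>
  The linear extensions of the bijection and of its inverse are inverse to each other, since their
  composites fix a basis.
\<close>

lemma linear_bij_extension:
  fixes V :: "('k, 'v) module" and W :: "('k, 'w) module"
  assumes V: "vectorspace K V" and W: "vectorspace K W"
    and B: "finite B" "vectorspace.basis K V B" and C: "vectorspace.basis K W C"
    and s: "bij_betw \<sigma> B C"
  obtains \<phi> where "linear_map K V W \<phi>" "bij_betw \<phi> (carrier V) (carrier W)" "\<And>b. b \<in> B \<Longrightarrow> \<phi> b = \<sigma> b"
proof -
  interpret V: vectorspace K V by fact
  interpret W: vectorspace K W by fact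
  have BV: "B \<subseteq> carrier V" using B V.basis_subset_carrier by blast
  have CW: "C \<subseteq> carrier W" using C W.basis_subset_carrier by blast
  have finC: "finite C" using B s bij_betw_finite by blast
  have s': "\<sigma> \<in> B \<rightarrow> carrier W" using s CW by (auto simp: bij_betw_def)
  have t': "inv_into B \<sigma> \<in> C \<rightarrow> carrier V"
    using bij_betw_inv_into[OF s] BV by (auto simp: bij_betw_def)
  obtain \<phi> where p: "linear_map K V W \<phi>" "\<And>b. b \<in> B \<Longrightarrow> \<phi> b = \<sigma> b"
    using linear_extension[OF V W B s'] by blast
  obtain \<psi> where q: "linear_map K W V \<psi>" "\<And>c. c \<in> C \<Longrightarrow> \<psi> c = inv_into B \<sigma> c"
    using linear_extension[OF W V finC C t'] by blast
  interpret p: linear_map K V W \<phi> by fact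
  interpret q: linear_map K W V \<psi> by fact
  have idV: "linear_map K V V (\<lambda>v. v)" by (rule linear_mapI[OF V V]) auto
  have idW: "linear_map K W W (\<lambda>v. v)" by (rule linear_mapI[OF W W]) auto
  have 1: "\<psi> (\<phi> v) = v" if "v \<in> carrier V" for v
  proof (rule linear_maps_eq_on_basis[OF linear_map_comp[OF p(1) q(1)] idV B _ that])
    fix b assume "b \<in> B"
    then show "\<psi> (\<phi> b) = b"
      using p(2) q(2)[of "\<sigma> b"] s bij_betw_inv_into_left[OF s] by (auto simp: bij_betw_def)
  qed
  have 2: "\<phi> (\<psi> w) = w" if "w \<in> carrier W" for w
  proof (rule linear_maps_eq_on_basis[OF linear_map_comp[OF q(1) p(1)] idW finC C _ that])
    fix c assume c: "c \<in> C"
    then have "inv_into B \<sigma> c \<in> B" using bij_betw_inv_into[OF s] by (auto simp: bij_betw_def)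
    then show "\<phi> (\<psi> c) = c"
      using p(2) q(2)[OF c] bij_betw_inv_into_right[OF s c] by auto
  qed
  have "bij_betw \<phi> (carrier V) (carrier W)"
    by (rule bij_betw_byWitness[of _ \<psi>]) (use 1 2 p.f_im q.f_im in auto)
  then show thesis using that p by blast
qed

text \<open>
  Apply \<open>zero_one_column_iff\<close> to every column. The bases are finite because the spaces are
  finite-dimensional, so coordinates make sense.
\<close>

lemma component_basis_iff:
  assumes M: "persistence_module K P M"
  shows "component_basis K P M B \<longleftrightarrow>
    (\<forall>q\<in>P. vectorspace.basis K (pm_obj M q) (B q)) \<and>
    (\<forall>q\<in>P. \<forall>p\<in>P. q \<le> p \<longrightarrow> pm_mor M q p ` B q \<subseteq> B p)"
proof -
  have fin: "finite (B q)" if "q \<in> P" "vectorspace.basis K (pm_obj M q) (B q)" for q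
  proof -
    interpret V: vectorspace K "pm_obj M q" using M that by (auto simp: persistence_module_def)
    show ?thesis using M that V.fin_dim_li_fin by (auto simp: persistence_module_def V.basis_def)
  qed
  have "(\<forall>b\<in>B q.
           (\<forall>c\<in>B p. matrix_entry K (pm_obj M p) (B p) (pm_mor M q p) c b \<in> {\<zero>\<^bsub>K\<^esub>, \<one>\<^bsub>K\<^esub>}) \<and>
           (\<exists>!c. c \<in> B p \<and> matrix_entry K (pm_obj M p) (B p) (pm_mor M q p) c b = \<one>\<^bsub>K\<^esub>))
     \<longleftrightarrow> pm_mor M q p ` B q \<subseteq> B p"
    if bas: "\<forall>q\<in>P. vectorspace.basis K (pm_obj M q) (B q)" and q: "q \<in> P" and p: "p \<in> P" and le: "q \<le> p" for q p
  proof -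
    interpret T: linear_map K "pm_obj M q" "pm_obj M p" "pm_mor M q p"
      using M q p le by (auto simp: persistence_module_def)
    have "B q \<subseteq> carrier (pm_obj M q)" using bas q T.V.basis_subset_carrier by blast
    then show ?thesis
      unfolding matrix_entry_def image_subset_iff
      using zero_one_column_iff[OF T.W.vectorspace_axioms fin[OF p], of "pm_mor M q p _"] bas p T.f_im
      by (intro ball_cong refl) blast
  qed
  then show ?thesis unfolding component_basis_def by (simp cong: conj_cong)
qed

section \<open>Finitely supported functions and their pushforwards\<close>

text \<open>
  The free \<open>K\<close>-module on \<open>S\<close>, realized by functions on the whole ambient type. The singular chains are the
  case where \<open>S\<close> is the set of singular simplices.
\<close>

definition finsupp :: "('k, 'm) ring_scheme \<Rightarrow> 'x set \<Rightarrow> ('x \<Rightarrow> 'k) set" where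
  "finsupp K S = {c. finite {f. c f \<noteq> \<zero>\<^bsub>K\<^esub>} \<and> range c \<subseteq> carrier K \<and> {f. c f \<noteq> \<zero>\<^bsub>K\<^esub>} \<subseteq> S}"

definition point_mass :: "('k, 'm) ring_scheme \<Rightarrow> 'k \<Rightarrow> 'x \<Rightarrow> 'x \<Rightarrow> 'k" where
  "point_mass K a f = (\<lambda>g. if g = f then a else \<zero>\<^bsub>K\<^esub>)"

text \<open>
  The linear extension of \<open>h\<close> to the free modules. Chain maps and the two halves of the boundary of a
  1-chain are pushforwards, so that both can be treated by functoriality in \<open>h\<close>.
\<close>

definition pushforward :: "('k, 'm) ring_scheme \<Rightarrow> ('x \<Rightarrow> 'y) \<Rightarrow> ('x \<Rightarrow> 'k) \<Rightarrow> 'y \<Rightarrow> 'k" where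
  "pushforward K h c = (\<lambda>g. \<Oplus>\<^bsub>K\<^esub> f \<in> {f. c f \<noteq> \<zero>\<^bsub>K\<^esub> \<and> h f = g}. c f)"

lemma carrier_chain_space: "carrier (chain_space K p T) = finsupp K (singular_simplex_set p T)"
  by (auto simp: chain_space_def finsupp_def)

lemma K_chain_map_eq_pushforward: "K_chain_map K p h = pushforward K (simplex_map p h)"
  by (simp add: K_chain_map_def pushforward_def fun_eq_iff)

lemma chain_space_simps [simp]:
  "\<zero>\<^bsub>chain_space K p T\<^esub> = (\<lambda>f. \<zero>\<^bsub>K\<^esub>)"
  "c \<oplus>\<^bsub>chain_space K p T\<^esub> d = (\<lambda>f. c f \<oplus>\<^bsub>K\<^esub> d f)"
  "a \<odot>\<^bsub>chain_space K p T\<^esub> c = (\<lambda>f. a \<otimes>\<^bsub>K\<^esub> c f)"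
  by (simp_all add: chain_space_def)

lemma finsupp_closed [simp]: "c \<in> finsupp K S \<Longrightarrow> c f \<in> carrier K"
  by (auto simp: finsupp_def)

lemma finsuppI:
  assumes "finite F" "\<And>f. c f \<in> carrier K" "\<And>f. c f \<noteq> \<zero>\<^bsub>K\<^esub> \<Longrightarrow> f \<in> F \<inter> S"
  shows "c \<in> finsupp K S"
proof -
  have "{f. c f \<noteq> \<zero>\<^bsub>K\<^esub>} \<subseteq> F \<inter> S" using assms(3) by blast
  then show ?thesis using assms(1,2) finite_subset[of _ "F \<inter> S"] by (auto simp: finsupp_def)
qed

lemma finsuppD:
  assumes "c \<in> finsupp K S"
  shows "finite {f. c f \<noteq> \<zero>\<^bsub>K\<^esub>}" "\<And>f. c f \<noteq> \<zero>\<^bsub>K\<^esub> \<Longrightarrow> f \<in> S"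
  using assms by (auto simp: finsupp_def)

lemma finsupp_mono: "c \<in> finsupp K S \<Longrightarrow> S \<subseteq> S' \<Longrightarrow> c \<in> finsupp K S'"
  by (auto simp: finsupp_def)

context
  fixes K :: "('k, 'm) ring_scheme"
  assumes K: "field K"
begin

interpretation field K by (fact K)

lemma finsupp_zero: "(\<lambda>f. \<zero>\<^bsub>K\<^esub>) \<in> finsupp K S"
  by (auto simp: finsupp_def)

lemma finsupp_add:
  assumes c: "c \<in> finsupp K S" and d: "d \<in> finsupp K S"
  shows "(\<lambda>f. c f \<oplus>\<^bsub>K\<^esub> d f) \<in> finsupp K S"
proof (rule finsuppI)
  show "finite ({f. c f \<noteq> \<zero>\<^bsub>K\<^esub>} \<union> {f. d f \<noteq> \<zero>\<^bsub>K\<^esub>})"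
    using finsuppD[OF c] finsuppD[OF d] by simp
  fix f show "c f \<oplus>\<^bsub>K\<^esub> d f \<in> carrier K" using c d by simp
  assume "c f \<oplus>\<^bsub>K\<^esub> d f \<noteq> \<zero>\<^bsub>K\<^esub>"
  then have "c f \<noteq> \<zero>\<^bsub>K\<^esub> \<or> d f \<noteq> \<zero>\<^bsub>K\<^esub>" by auto
  then show "f \<in> ({f. c f \<noteq> \<zero>\<^bsub>K\<^esub>} \<union> {f. d f \<noteq> \<zero>\<^bsub>K\<^esub>}) \<inter> S"
    using finsuppD(2)[OF c] finsuppD(2)[OF d] by blast
qed

lemma finsupp_smult:
  assumes c: "c \<in> finsupp K S" and a: "a \<in> carrier K"
  shows "(\<lambda>f. a \<otimes>\<^bsub>K\<^esub> c f) \<in> finsupp K S"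
proof (rule finsuppI)
  show "finite {f. c f \<noteq> \<zero>\<^bsub>K\<^esub>}" using finsuppD[OF c] by simp
  fix f show "a \<otimes>\<^bsub>K\<^esub> c f \<in> carrier K" using c a by simp
  assume "a \<otimes>\<^bsub>K\<^esub> c f \<noteq> \<zero>\<^bsub>K\<^esub>"
  then have "c f \<noteq> \<zero>\<^bsub>K\<^esub>" using a by auto
  then show "f \<in> {f. c f \<noteq> \<zero>\<^bsub>K\<^esub>} \<inter> S" using finsuppD(2)[OF c] by blast
qed

lemma finsupp_point_mass: "f \<in> S \<Longrightarrow> a \<in> carrier K \<Longrightarrow> point_mass K a f \<in> finsupp K S"
  by (auto simp: finsupp_def point_mass_def)

lemma finsupp_induct [consumes 1, case_names zero add]:
  assumes c: "c \<in> finsupp K S" and zero: "Q (\<lambda>f. \<zero>\<^bsub>K\<^esub>)"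
    and add: "\<And>c f a. c \<in> finsupp K S \<Longrightarrow> f \<in> S \<Longrightarrow> a \<in> carrier K \<Longrightarrow> Q c \<Longrightarrow> Q (\<lambda>g. c g \<oplus>\<^bsub>K\<^esub> point_mass K a f g)"
  shows "Q c"
proof -
  have "finite F \<Longrightarrow> c \<in> finsupp K S \<Longrightarrow> {f. c f \<noteq> \<zero>\<^bsub>K\<^esub>} \<subseteq> F \<Longrightarrow> Q c" for F c
  proof (induction F arbitrary: c rule: finite_induct)
    case empty
    then have "c = (\<lambda>f. \<zero>\<^bsub>K\<^esub>)" by auto
    then show ?case using zero by simp
  next
    case (insert f F)
    show ?case
    proof (cases "c f = \<zero>\<^bsub>K\<^esub>")
      case True
      then show ?thesis using insert.IH[OF insert.prems(1)] insert.prems by blast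
    next
      case False
      let ?d = "c(f := \<zero>\<^bsub>K\<^esub>)"
      have supp: "{g. ?d g \<noteq> \<zero>\<^bsub>K\<^esub>} = {g. c g \<noteq> \<zero>\<^bsub>K\<^esub>} - {f}" by auto
      have d: "?d \<in> finsupp K S"
        using insert.prems(1) unfolding finsupp_def supp mem_Collect_eq by auto
      have "Q ?d" by (rule insert.IH[OF d]) (use insert.prems in auto)
      moreover have "f \<in> S" "c f \<in> carrier K" using insert.prems False by (auto simp: finsupp_def)
      moreover have "(\<lambda>g. ?d g \<oplus>\<^bsub>K\<^esub> point_mass K (c f) f g) = c"
        using insert.prems by (auto simp: point_mass_def fun_eq_iff)
      ultimately show ?thesis using add[OF d, of f "c f"] by simp
    qed
  qed
  then show ?thesis using c by (auto simp: finsupp_def)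
qed

text \<open>
  Summing over a superset of the support lets the sums of several chains be compared termwise.
\<close>

lemma pushforward_eq_finsum:
  assumes "finite F" "{f. c f \<noteq> \<zero>\<^bsub>K\<^esub>} \<subseteq> F" "range c \<subseteq> carrier K"
  shows "pushforward K h c g = (\<Oplus>\<^bsub>K\<^esub>f\<in>F. if h f = g then c f else \<zero>\<^bsub>K\<^esub>)"
  unfolding pushforward_def using assms
  by (intro add.finprod_mono_neutral_cong_left) (auto simp: image_subset_iff)

lemma pushforward_zero: "pushforward K h (\<lambda>f. \<zero>\<^bsub>K\<^esub>) = (\<lambda>g. \<zero>\<^bsub>K\<^esub>)"
  by (simp add: pushforward_def)

lemma pushforward_add:
  assumes c: "c \<in> finsupp K S" and d: "d \<in> finsupp K S"
  shows "pushforward K h (\<lambda>f. c f \<oplus>\<^bsub>K\<^esub> d f) = (\<lambda>g. pushforward K h c g \<oplus>\<^bsub>K\<^esub> pushforward K h d g)"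
proof
  fix g
  let ?F = "{f. c f \<noteq> \<zero>\<^bsub>K\<^esub>} \<union> {f. d f \<noteq> \<zero>\<^bsub>K\<^esub>}"
  have F: "finite ?F" "range c \<subseteq> carrier K" "range d \<subseteq> carrier K" using c d by (auto simp: finsupp_def)
  have "pushforward K h (\<lambda>f. c f \<oplus>\<^bsub>K\<^esub> d f) g = (\<Oplus>\<^bsub>K\<^esub>f\<in>?F. if h f = g then c f \<oplus>\<^bsub>K\<^esub> d f else \<zero>\<^bsub>K\<^esub>)"
    by (rule pushforward_eq_finsum) (use F in \<open>auto simp: image_subset_iff\<close>)
  also have "\<dots> = (\<Oplus>\<^bsub>K\<^esub>f\<in>?F. (if h f = g then c f else \<zero>\<^bsub>K\<^esub>) \<oplus>\<^bsub>K\<^esub> (if h f = g then d f else \<zero>\<^bsub>K\<^esub>))"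
    by (rule finsum_cong') (use F in \<open>auto simp: image_subset_iff\<close>)
  also have "\<dots> = (\<Oplus>\<^bsub>K\<^esub>f\<in>?F. if h f = g then c f else \<zero>\<^bsub>K\<^esub>) \<oplus>\<^bsub>K\<^esub> (\<Oplus>\<^bsub>K\<^esub>f\<in>?F. if h f = g then d f else \<zero>\<^bsub>K\<^esub>)"
    by (rule finsum_addf) (use F in \<open>auto simp: image_subset_iff\<close>)
  also have "\<dots> = pushforward K h c g \<oplus>\<^bsub>K\<^esub> pushforward K h d g"
    using F by (subst (1 2) pushforward_eq_finsum[OF F(1)]) auto
  finally show "pushforward K h (\<lambda>f. c f \<oplus>\<^bsub>K\<^esub> d f) g = pushforward K h c g \<oplus>\<^bsub>K\<^esub> pushforward K h d g" .
qed

lemma pushforward_smult: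
  assumes c: "c \<in> finsupp K S" and a: "a \<in> carrier K"
  shows "pushforward K h (\<lambda>f. a \<otimes>\<^bsub>K\<^esub> c f) = (\<lambda>g. a \<otimes>\<^bsub>K\<^esub> pushforward K h c g)"
proof
  fix g
  let ?F = "{f. c f \<noteq> \<zero>\<^bsub>K\<^esub>}"
  have F: "finite ?F" "range c \<subseteq> carrier K" using c by (auto simp: finsupp_def)
  have "pushforward K h (\<lambda>f. a \<otimes>\<^bsub>K\<^esub> c f) g = (\<Oplus>\<^bsub>K\<^esub>f\<in>?F. if h f = g then a \<otimes>\<^bsub>K\<^esub> c f else \<zero>\<^bsub>K\<^esub>)"
    by (rule pushforward_eq_finsum) (use F a in \<open>auto simp: image_subset_iff\<close>)
  also have "\<dots> = (\<Oplus>\<^bsub>K\<^esub>f\<in>?F. a \<otimes>\<^bsub>K\<^esub> (if h f = g then c f else \<zero>\<^bsub>K\<^esub>))"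
    by (rule finsum_cong') (use F a in \<open>auto simp: image_subset_iff\<close>)
  also have "\<dots> = a \<otimes>\<^bsub>K\<^esub> pushforward K h c g"
    using F a c by (subst pushforward_eq_finsum[OF F(1) subset_refl F(2)], subst finsum_rdistr) simp_all
  finally show "pushforward K h (\<lambda>f. a \<otimes>\<^bsub>K\<^esub> c f) g = a \<otimes>\<^bsub>K\<^esub> pushforward K h c g" .
qed

lemma pushforward_point_mass:
  assumes "a \<in> carrier K" shows "pushforward K h (point_mass K a f) = point_mass K a (h f)"
proof
  fix g
  have "pushforward K h (point_mass K a f) g = (\<Oplus>\<^bsub>K\<^esub>e\<in>{f}. if h e = g then point_mass K a f e else \<zero>\<^bsub>K\<^esub>)"
    by (rule pushforward_eq_finsum) (use assms in \<open>auto simp: point_mass_def\<close>)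
  also have "\<dots> = point_mass K a (h f) g" using assms by (simp add: point_mass_def)
  finally show "pushforward K h (point_mass K a f) g = point_mass K a (h f) g" .
qed

lemma pushforward_finsupp:
  assumes c: "c \<in> finsupp K S" and h: "h \<in> S \<rightarrow> S'"
  shows "pushforward K h c \<in> finsupp K S'"
  using c
proof (induction c rule: finsupp_induct)
  case zero then show ?case by (simp add: pushforward_zero finsupp_zero)
next
  case (add c f a)
  have "h f \<in> S'" using h add(2) by blast
  then show ?case
    unfolding pushforward_add[OF add(1) finsupp_point_mass[OF add(2,3)]] pushforward_point_mass[OF add(3)]
    by (intro finsupp_add finsupp_point_mass add)
qed

text \<open>
  Both sides are linear in \<open>c\<close> and agree on point masses.
\<close>

lemma pushforward_pushforward:
  assumes c: "c \<in> finsupp K S"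
  shows "pushforward K k (pushforward K h c) = pushforward K (\<lambda>f. k (h f)) c"
  using c
proof (induction c rule: finsupp_induct)
  case zero then show ?case by (simp add: pushforward_zero)
next
  case (add c f a)
  have 1: "pushforward K h c \<in> finsupp K UNIV" "point_mass K a (h f) \<in> finsupp K UNIV"
    using add by (auto intro: pushforward_finsupp finsupp_point_mass)
  show ?case
    using add(2-)
    by (simp add: pushforward_add[OF add(1) finsupp_point_mass[OF add(2,3)]] pushforward_add[OF 1] pushforward_point_mass)
qed

lemma pushforward_cong:
  assumes c: "c \<in> finsupp K S" and h: "\<And>f. f \<in> S \<Longrightarrow> h f = k f"
  shows "pushforward K h c = pushforward K k c"
proof -
  have "{f. c f \<noteq> \<zero>\<^bsub>K\<^esub> \<and> h f = g} = {f. c f \<noteq> \<zero>\<^bsub>K\<^esub> \<and> k f = g}" for g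
    using assms by (auto simp: finsupp_def)
  then show ?thesis by (simp add: pushforward_def)
qed

lemma pushforward_id:
  assumes c: "c \<in> finsupp K S"
  shows "pushforward K (\<lambda>f. f) c = c"
  using c
proof (induction c rule: finsupp_induct)
  case zero then show ?case by (simp add: pushforward_zero)
next
  case (add c f a)
  then show ?case by (simp add: pushforward_add[OF add(1) finsupp_point_mass[OF add(2,3)]] pushforward_point_mass)
qed

lemma vectorspace_chain_space: "vectorspace K (chain_space K p T)"
proof (rule vs_criteria[OF K])
  let ?V = "chain_space K p T"
  show "\<forall>v\<in>carrier ?V. \<exists>w\<in>carrier ?V. v \<oplus>\<^bsub>?V\<^esub> w = \<zero>\<^bsub>?V\<^esub>"
  proof
    fix v assume v: "v \<in> carrier ?V"
    have "(\<lambda>f. \<ominus>\<^bsub>K\<^esub> \<one>\<^bsub>K\<^esub> \<otimes>\<^bsub>K\<^esub> v f) \<in> carrier ?V"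
      using v finsupp_smult[of v _ "\<ominus>\<^bsub>K\<^esub> \<one>\<^bsub>K\<^esub>"] by (simp add: carrier_chain_space)
    moreover have "v \<oplus>\<^bsub>?V\<^esub> (\<lambda>f. \<ominus>\<^bsub>K\<^esub> \<one>\<^bsub>K\<^esub> \<otimes>\<^bsub>K\<^esub> v f) = \<zero>\<^bsub>?V\<^esub>"
      using v by (auto simp: carrier_chain_space fun_eq_iff l_minus r_neg)
    ultimately show "\<exists>w\<in>carrier ?V. v \<oplus>\<^bsub>?V\<^esub> w = \<zero>\<^bsub>?V\<^esub>" by blast
  qed
qed (safe, simp_all add: carrier_chain_space finsupp_zero finsupp_add finsupp_smult fun_eq_iff
      a_ac m_assoc l_distr r_distr)

text \<open>
  The boundary of a 1-simplex is its face 0 minus its face 1. The minus sign is written as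
  multiplication by \<open>-1\<close>, so that the right-hand side is a sum of multiples of pushforwards.
\<close>

lemma K_boundary_1:
  assumes c: "c \<in> finsupp K S"
  shows "K_boundary K (Suc 0) c = (\<lambda>g. pushforward K (singular_face (Suc 0) 0) c g \<oplus>\<^bsub>K\<^esub> \<ominus>\<^bsub>K\<^esub> \<one>\<^bsub>K\<^esub> \<otimes>\<^bsub>K\<^esub> pushforward K (singular_face (Suc 0) (Suc 0)) c g)"
proof
  fix g
  let ?F = "{f. c f \<noteq> \<zero>\<^bsub>K\<^esub>}" and ?d = "\<lambda>k. singular_face (Suc 0) k :: ((nat \<Rightarrow> real) \<Rightarrow> _) \<Rightarrow> _"
  have F: "finite ?F" "range c \<subseteq> carrier K" using c by (auto simp: finsupp_def)
  have inner: "(\<Oplus>\<^bsub>K\<^esub>k\<in>{k. k \<le> Suc 0 \<and> ?d k f = g}. (\<ominus>\<^bsub>K\<^esub> \<one>\<^bsub>K\<^esub>) [^]\<^bsub>K\<^esub> k \<otimes>\<^bsub>K\<^esub> c f)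
     = (if ?d 0 f = g then c f else \<zero>\<^bsub>K\<^esub>) \<oplus>\<^bsub>K\<^esub> \<ominus>\<^bsub>K\<^esub> \<one>\<^bsub>K\<^esub> \<otimes>\<^bsub>K\<^esub> (if ?d (Suc 0) f = g then c f else \<zero>\<^bsub>K\<^esub>)" for f
  proof -
    have "(\<Oplus>\<^bsub>K\<^esub>k\<in>{k. k \<le> Suc 0 \<and> ?d k f = g}. (\<ominus>\<^bsub>K\<^esub> \<one>\<^bsub>K\<^esub>) [^]\<^bsub>K\<^esub> k \<otimes>\<^bsub>K\<^esub> c f)
      = (\<Oplus>\<^bsub>K\<^esub>k\<in>{0, Suc 0}. if ?d k f = g then (\<ominus>\<^bsub>K\<^esub> \<one>\<^bsub>K\<^esub>) [^]\<^bsub>K\<^esub> k \<otimes>\<^bsub>K\<^esub> c f else \<zero>\<^bsub>K\<^esub>)"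
      using c by (intro add.finprod_mono_neutral_cong_left) (auto simp: le_Suc_eq)
    then show ?thesis using c by simp
  qed
  have "K_boundary K (Suc 0) c g = (\<Oplus>\<^bsub>K\<^esub>f\<in>?F. (if ?d 0 f = g then c f else \<zero>\<^bsub>K\<^esub>) \<oplus>\<^bsub>K\<^esub> \<ominus>\<^bsub>K\<^esub> \<one>\<^bsub>K\<^esub> \<otimes>\<^bsub>K\<^esub> (if ?d (Suc 0) f = g then c f else \<zero>\<^bsub>K\<^esub>))"
    unfolding K_boundary_def inner by simp
  also have "\<dots> = (\<Oplus>\<^bsub>K\<^esub>f\<in>?F. if ?d 0 f = g then c f else \<zero>\<^bsub>K\<^esub>) \<oplus>\<^bsub>K\<^esub> (\<Oplus>\<^bsub>K\<^esub>f\<in>?F. \<ominus>\<^bsub>K\<^esub> \<one>\<^bsub>K\<^esub> \<otimes>\<^bsub>K\<^esub> (if ?d (Suc 0) f = g then c f else \<zero>\<^bsub>K\<^esub>))"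
    using c by (intro finsum_addf) auto
  also have "\<dots> = pushforward K (?d 0) c g \<oplus>\<^bsub>K\<^esub> \<ominus>\<^bsub>K\<^esub> \<one>\<^bsub>K\<^esub> \<otimes>\<^bsub>K\<^esub> pushforward K (?d (Suc 0)) c g"
    using c F by (subst (1 2) pushforward_eq_finsum[OF F(1)]) (auto simp: finsum_rdistr)
  finally show "K_boundary K (Suc 0) c g = pushforward K (?d 0) c g \<oplus>\<^bsub>K\<^esub> \<ominus>\<^bsub>K\<^esub> \<one>\<^bsub>K\<^esub> \<otimes>\<^bsub>K\<^esub> pushforward K (?d (Suc 0)) c g" .
qed

end

section \<open>Quotients by kernels\<close>

text \<open>
  When \<open>N\<close> is the kernel of a linear map \<open>g\<close>, the coset of \<open>v\<close> is the fibre of \<open>g\<close> through \<open>v\<close>. With this,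
  the operations on cosets are seen to be induced from \<open>V\<close>, and the axioms carry over along the
  surjection onto the quotient.
\<close>

lemma coset_module_kernel:
  assumes g: "linear_map K V U g"
  defines "N \<equiv> {v \<in> carrier V. g v = \<zero>\<^bsub>U\<^esub>}"
  defines "Q \<equiv> coset_module V (carrier V) N"
  shows "vectorspace K Q" "linear_map K V Q (\<lambda>v. N +>\<^bsub>V\<^esub> v)"
    and "carrier Q = (\<lambda>v. N +>\<^bsub>V\<^esub> v) ` carrier V"
    and coset_eq_fibre: "\<And>v. v \<in> carrier V \<Longrightarrow> N +>\<^bsub>V\<^esub> v = {w \<in> carrier V. g w = g v}"
proof -
  interpret g: linear_map K V U g by fact
  let ?cl = "\<lambda>v. N +>\<^bsub>V\<^esub> v"
  have cl: "?cl v = {w \<in> carrier V. g w = g v}" if v: "v \<in> carrier V" for v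
  proof -
    have "w \<in> ?cl v" if w: "w \<in> carrier V" "g w = g v" for w
    proof -
      have "w \<ominus>\<^bsub>V\<^esub> v \<in> N"
        using w v by (auto simp: N_def g.V.module.M.minus_closed g.W.module.M.r_neg g.W.module.M.minus_eq)
      moreover have "w = (w \<ominus>\<^bsub>V\<^esub> v) \<oplus>\<^bsub>V\<^esub> v"
        using w v by (simp add: g.V.module.M.minus_eq g.V.module.M.a_assoc g.V.module.M.l_neg)
      ultimately show ?thesis unfolding a_r_coset_def' by blast
    qed
    moreover have "w \<in> carrier V \<and> g w = g v" if "w \<in> ?cl v" for w
      using that v unfolding a_r_coset_def' by (auto simp: N_def)
    ultimately show ?thesis by blast
  qed
  then show "\<And>v. v \<in> carrier V \<Longrightarrow> ?cl v = {w \<in> carrier V. g w = g v}" .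
  show car: "carrier Q = ?cl ` carrier V" by (simp add: Q_def coset_module_def)
  have zero: "\<zero>\<^bsub>Q\<^esub> = ?cl \<zero>\<^bsub>V\<^esub>"
    by (subst cl) (auto simp: Q_def coset_module_def N_def)
  have add: "?cl v \<oplus>\<^bsub>Q\<^esub> ?cl w = ?cl (v \<oplus>\<^bsub>V\<^esub> w)" if v: "v \<in> carrier V" and w: "w \<in> carrier V" for v w
  proof -
    have "x \<in> ?cl v <+>\<^bsub>V\<^esub> ?cl w" if x: "x \<in> ?cl (v \<oplus>\<^bsub>V\<^esub> w)" for x
    proof -
      have xV: "x \<in> carrier V" and gx: "g x = g v \<oplus>\<^bsub>U\<^esub> g w" using x v w cl[of "v \<oplus>\<^bsub>V\<^esub> w"] by auto
      have "g (x \<ominus>\<^bsub>V\<^esub> v) = g w"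
        using xV v w gx
        by (simp add: g.W.module.M.minus_eq g.W.module.M.a_lcomm[of "g v" "g w"] g.W.module.M.r_neg g.W.module.M.a_assoc)
      then have "x \<ominus>\<^bsub>V\<^esub> v \<in> ?cl w" using cl[OF w] xV v by (simp add: g.V.module.M.minus_closed)
      moreover have "v \<in> ?cl v" using cl[OF v] v by simp
      moreover have "x = v \<oplus>\<^bsub>V\<^esub> (x \<ominus>\<^bsub>V\<^esub> v)"
        using xV v by (simp add: g.V.module.M.minus_eq g.V.module.M.a_lcomm[of v x] g.V.module.M.r_neg)
      ultimately show ?thesis unfolding set_add_def' by blast
    qed
    moreover have "?cl v <+>\<^bsub>V\<^esub> ?cl w \<subseteq> ?cl (v \<oplus>\<^bsub>V\<^esub> w)"
      using cl v w unfolding set_add_def' by auto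
    ultimately show ?thesis by (auto simp: Q_def coset_module_def)
  qed
  have smult: "a \<odot>\<^bsub>Q\<^esub> ?cl v = ?cl (a \<odot>\<^bsub>V\<^esub> v)" if a: "a \<in> carrier K" and v: "v \<in> carrier V" for a v
  proof -
    have av: "a \<odot>\<^bsub>V\<^esub> v \<in> carrier V" using a v by simp
    have "x \<in> N <+>\<^bsub>V\<^esub> (\<lambda>s. a \<odot>\<^bsub>V\<^esub> s) ` ?cl v" if x: "x \<in> ?cl (a \<odot>\<^bsub>V\<^esub> v)" for x
    proof -
      obtain n where "n \<in> N" "x = n \<oplus>\<^bsub>V\<^esub> (a \<odot>\<^bsub>V\<^esub> v)" using x unfolding a_r_coset_def' by auto
      moreover have "v \<in> ?cl v" using cl[OF v] v by simp
      ultimately show ?thesis unfolding set_add_def' by blast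
    qed
    moreover have "N <+>\<^bsub>V\<^esub> (\<lambda>s. a \<odot>\<^bsub>V\<^esub> s) ` ?cl v \<subseteq> ?cl (a \<odot>\<^bsub>V\<^esub> v)"
      unfolding cl[OF v] cl[OF av] set_add_def' using a v by (auto simp: N_def)
    ultimately show ?thesis by (auto simp: Q_def coset_module_def)
  qed
  show vs: "vectorspace K Q"
  proof (rule vs_criteria)
    show "field K" by (rule g.V.field.field_axioms)
    show "\<zero>\<^bsub>Q\<^esub> \<in> carrier Q" by (simp add: zero car)
    show "\<forall>v w. v \<in> carrier Q \<and> w \<in> carrier Q \<longrightarrow> v \<oplus>\<^bsub>Q\<^esub> w \<in> carrier Q"
      by (auto simp: car add)
    show "\<forall>v\<in>carrier Q. \<exists>neg_v\<in>carrier Q. v \<oplus>\<^bsub>Q\<^esub> neg_v = \<zero>\<^bsub>Q\<^esub>"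
    proof
      fix S assume "S \<in> carrier Q"
      then obtain v where v: "v \<in> carrier V" "S = ?cl v" by (auto simp: car)
      have "S \<oplus>\<^bsub>Q\<^esub> ?cl (\<ominus>\<^bsub>V\<^esub> v) = \<zero>\<^bsub>Q\<^esub>"
        using v by (simp add: add zero g.V.module.M.r_neg)
      then show "\<exists>neg_v\<in>carrier Q. S \<oplus>\<^bsub>Q\<^esub> neg_v = \<zero>\<^bsub>Q\<^esub>" using v car by blast
    qed
    show "\<forall>c v. c \<in> carrier K \<and> v \<in> carrier Q \<longrightarrow> c \<odot>\<^bsub>Q\<^esub> v \<in> carrier Q"
      by (auto simp: car smult)
    show "\<forall>v w. v \<in> carrier Q \<and> w \<in> carrier Q \<longrightarrow> v \<oplus>\<^bsub>Q\<^esub> w = w \<oplus>\<^bsub>Q\<^esub> v"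
      by (auto simp: car add g.V.module.M.a_comm)
    show "\<forall>v w x. v \<in> carrier Q \<and> w \<in> carrier Q \<and> x \<in> carrier Q \<longrightarrow> v \<oplus>\<^bsub>Q\<^esub> w \<oplus>\<^bsub>Q\<^esub> x = v \<oplus>\<^bsub>Q\<^esub> (w \<oplus>\<^bsub>Q\<^esub> x)"
      by (auto simp: car add g.V.module.M.a_assoc)
    show "\<forall>v\<in>carrier Q. v \<oplus>\<^bsub>Q\<^esub> \<zero>\<^bsub>Q\<^esub> = v"
      by (auto simp: car add zero)
    show "\<forall>a b v. a \<in> carrier K \<and> b \<in> carrier K \<and> v \<in> carrier Q \<longrightarrow> (a \<otimes>\<^bsub>K\<^esub> b) \<odot>\<^bsub>Q\<^esub> v = a \<odot>\<^bsub>Q\<^esub> (b \<odot>\<^bsub>Q\<^esub> v)"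
      by (auto simp: car smult g.V.module.smult_assoc1)
    show "\<forall>v\<in>carrier Q. \<one>\<^bsub>K\<^esub> \<odot>\<^bsub>Q\<^esub> v = v"
      by (auto simp: car smult)
    show "\<forall>a b v. a \<in> carrier K \<and> b \<in> carrier K \<and> v \<in> carrier Q \<longrightarrow> (a \<oplus>\<^bsub>K\<^esub> b) \<odot>\<^bsub>Q\<^esub> v = a \<odot>\<^bsub>Q\<^esub> v \<oplus>\<^bsub>Q\<^esub> b \<odot>\<^bsub>Q\<^esub> v"
      by (auto simp: car smult add g.V.module.smult_l_distr)
    show "\<forall>a v w. a \<in> carrier K \<and> v \<in> carrier Q \<and> w \<in> carrier Q \<longrightarrow> a \<odot>\<^bsub>Q\<^esub> (v \<oplus>\<^bsub>Q\<^esub> w) = a \<odot>\<^bsub>Q\<^esub> v \<oplus>\<^bsub>Q\<^esub> a \<odot>\<^bsub>Q\<^esub> w"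
      by (auto simp: car smult add g.V.module.smult_r_distr)
  qed
  show "linear_map K V Q ?cl"
    by (rule linear_mapI[OF g.V.vectorspace_axioms vs]) (auto simp: car add smult)
qed

section \<open>Points, paths and homology in degree zero\<close>

definition pt_simplex :: "'a \<Rightarrow> (nat \<Rightarrow> real) \<Rightarrow> 'a" where
  "pt_simplex x = restrict (\<lambda>_. x) (standard_simplex 0)"

definition simplex_pt :: "((nat \<Rightarrow> real) \<Rightarrow> 'a) \<Rightarrow> 'a" where
  "simplex_pt f = f (\<lambda>j. if j = 0 then 1 else 0)"

lemma simplex_pt_pt_simplex [simp]: "simplex_pt (pt_simplex x) = x"
  by (simp add: simplex_pt_def pt_simplex_def standard_simplex_0)

lemma singular_simplex_0_iff: "singular_simplex 0 T f \<longleftrightarrow> (\<exists>x\<in>topspace T. f = pt_simplex x)"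
proof
  assume f: "singular_simplex 0 T f"
  then have "simplex_pt f \<in> topspace T"
    by (auto simp: singular_simplex_def continuous_map_def simplex_pt_def standard_simplex_0)
  moreover have "f = pt_simplex (simplex_pt f)"
    using f by (auto simp: singular_simplex_def extensional_def pt_simplex_def simplex_pt_def standard_simplex_0)
  ultimately show "\<exists>x\<in>topspace T. f = pt_simplex x" by blast
next
  assume "\<exists>x\<in>topspace T. f = pt_simplex x"
  then obtain x where x: "x \<in> topspace T" "f = pt_simplex x" by blast
  have "continuous_map (subtopology (powertop_real UNIV) (standard_simplex 0)) T (\<lambda>_. x)"
    using x by simp
  then have "continuous_map (subtopology (powertop_real UNIV) (standard_simplex 0)) T f"
    by (rule continuous_map_eq) (simp add: x pt_simplex_def)
  then show "singular_simplex 0 T f" by (simp add: singular_simplex_def x pt_simplex_def)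
qed

text \<open>
  The image of the standard simplex is path connected and contains both ends.
\<close>

lemma path_component_of_singular_1_simplex:
  assumes f: "singular_simplex (Suc 0) T f" and "k \<le> Suc 0" "l \<le> Suc 0"
  shows "path_component_of T (simplex_pt (singular_face (Suc 0) k f)) (simplex_pt (singular_face (Suc 0) l f))"
proof -
  have "path_connectedin T (f ` standard_simplex (Suc 0))"
    by (rule path_connectedin_continuous_map_image)
       (use f path_connectedin_standard_simplex in \<open>auto simp: singular_simplex_def path_connectedin_subtopology\<close>)
  moreover have "simplex_pt (singular_face (Suc 0) k f) \<in> f ` standard_simplex (Suc 0)" if "k \<le> Suc 0" for k
  proof -
    have "simplical_face k (\<lambda>j. if j = 0 then 1 else 0) \<in> standard_simplex (Suc 0)"
      using that by (intro simplical_face_in_standard_simplex) (auto simp: standard_simplex_0)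
    then show ?thesis by (auto simp: simplex_pt_def singular_face_def standard_simplex_0)
  qed
  ultimately show ?thesis
    using assms(2,3) by (intro path_component_of[THEN iffD2] exI[of _ "f ` standard_simplex (Suc 0)"] conjI) simp_all
qed

text \<open>
  The zeroth barycentric coordinate maps the standard 1-simplex onto the unit interval. Face 0 is the
  vertex where this coordinate vanishes, so it gives the start of the path.
\<close>

lemma singular_1_simplex_path_component_of:
  assumes "path_component_of T x y"
  obtains f where "singular_simplex (Suc 0) T f" "singular_face (Suc 0) 0 f = pt_simplex x"
    "singular_face (Suc 0) (Suc 0) f = pt_simplex y"
proof -
  obtain g where g: "pathin T g" and g0: "g 0 = x" and g1: "g 1 = y"
    using assms unfolding path_component_of_def by blast
  let ?f = "restrict (g \<circ> (\<lambda>x. x 0)) (standard_simplex (Suc 0))"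
  have "continuous_map (subtopology (powertop_real UNIV) (standard_simplex (Suc 0)))
                             euclideanreal (\<lambda>x. x 0)"
    by (metis (mono_tags) UNIV_I continuous_map_from_subtopology continuous_map_product_projection)
  then have "continuous_map (subtopology (powertop_real UNIV) (standard_simplex (Suc 0)))
                              (top_of_set {0..1}) (\<lambda>x. x 0)"
    by (auto simp: continuous_map_in_subtopology standard_simplex_def)
  moreover have "continuous_map (top_of_set {0..1}) T g" using g by (simp add: pathin_def)
  ultimately have "singular_simplex (Suc 0) T ?f"
    by (force simp: singular_simplex_def continuous_map_compose)
  moreover have "singular_face (Suc 0) 0 ?f = pt_simplex x" "singular_face (Suc 0) (Suc 0) ?f = pt_simplex y"
    by (auto simp: singular_face_def pt_simplex_def simplical_face_def standard_simplex_0 fun_eq_iff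
        standard_simplex_def g0 g1)
  ultimately show thesis using that by blast
qed

text \<open>
  Path-equivalent points have equal path component predicates, hence literally the same base point.
\<close>

definition base_pt :: "'a topology \<Rightarrow> 'a \<Rightarrow> 'a" where
  "base_pt T x = (SOME y. path_component_of T x y)"

text \<open>
  The pushforward along this function is the endomorphism \<open>\<rho>\<close> of the introduction.
\<close>

definition retract_simplex :: "'a topology \<Rightarrow> ((nat \<Rightarrow> real) \<Rightarrow> 'a) \<Rightarrow> (nat \<Rightarrow> real) \<Rightarrow> 'a" where
  "retract_simplex T f = pt_simplex (base_pt T (simplex_pt f))"

lemma path_component_of_base_pt: "x \<in> topspace T \<Longrightarrow> path_component_of T x (base_pt T x)"
  unfolding base_pt_def by (rule someI[of _ x]) (simp add: path_component_of_refl)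

lemma base_pt_in_topspace: "x \<in> topspace T \<Longrightarrow> base_pt T x \<in> topspace T"
  using path_component_of_base_pt path_component_in_topspace by metis

lemma base_pt_eq_iff:
  assumes "x \<in> topspace T" "y \<in> topspace T"
  shows "base_pt T x = base_pt T y \<longleftrightarrow> path_component_of T x y"
proof
  assume "path_component_of T x y"
  then have "path_component_of T x = path_component_of T y"
    by (metis path_component_of_equiv)
  then show "base_pt T x = base_pt T y" by (simp add: base_pt_def)
next
  assume "base_pt T x = base_pt T y"
  then show "path_component_of T x y"
    using assms path_component_of_base_pt by (metis path_component_of_sym path_component_of_trans)
qed

lemma pt_simplex_inject [simp]: "pt_simplex x = pt_simplex y \<longleftrightarrow> x = y"
  by (metis simplex_pt_pt_simplex)

lemma retract_simplex_pt_simplex [simp]: "retract_simplex T (pt_simplex x) = pt_simplex (base_pt T x)"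
  by (simp add: retract_simplex_def)

lemma retract_simplex_funcset: "retract_simplex T \<in> singular_simplex_set 0 T \<rightarrow> singular_simplex_set 0 T"
  by (auto simp: singular_simplex_0_iff base_pt_in_topspace)

definition homology_class :: "('k, 'm) ring_scheme \<Rightarrow> 'a topology \<Rightarrow> ('k, 'a) K_chain \<Rightarrow> ('k, 'a) K_chain set" where
  "homology_class K T c = K_boundaries K 0 T +>\<^bsub>chain_space K 0 T\<^esub> c"

definition point_class :: "('k, 'm) ring_scheme \<Rightarrow> 'a topology \<Rightarrow> 'a \<Rightarrow> ('k, 'a) K_chain set" where
  "point_class K T x = homology_class K T (point_mass K \<one>\<^bsub>K\<^esub> (pt_simplex x))"

context
  fixes K :: "('k, 'm) ring_scheme"
  assumes K: "field K"
begin

interpretation field K by (fact K)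

text \<open>
  Base points agree on the two ends of a 1-simplex, which gives one inclusion. For the other, let \<open>\<gamma>\<close>
  choose for every point a path from it to its base point. If the retraction kills \<open>d\<close>, the 1-chain
  obtained from \<open>d\<close> along \<open>\<gamma>\<close> has boundary \<open>d\<close>.
\<close>

lemma K_boundaries_0:
  "K_boundaries K 0 T = {d \<in> carrier (chain_space K 0 T). pushforward K (retract_simplex T) d = (\<lambda>f. \<zero>\<^bsub>K\<^esub>)}"
    (is "_ = ?R")
proof (intro equalityI subsetI)
  fix d assume "d \<in> K_boundaries K 0 T"
  then obtain c where c: "c \<in> finsupp K (singular_simplex_set (Suc 0) T)" and d: "d = K_boundary K (Suc 0) c"
    by (auto simp: K_boundaries_def carrier_chain_space)
  let ?d = "\<lambda>k. singular_face (Suc 0) k :: ((nat \<Rightarrow> real) \<Rightarrow> 'b) \<Rightarrow> _"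
  have face: "?d k \<in> singular_simplex_set (Suc 0) T \<rightarrow> singular_simplex_set 0 T" if "k \<le> Suc 0" for k
    using singular_simplex_singular_face[of "Suc 0" T _ k] that by auto
  have m: "\<ominus>\<^bsub>K\<^esub> \<one>\<^bsub>K\<^esub> \<in> carrier K" by simp
  note d = d[unfolded K_boundary_1[OF K c]]
  have p0: "pushforward K (?d 0) c \<in> finsupp K (singular_simplex_set 0 T)"
    and p1: "pushforward K (?d (Suc 0)) c \<in> finsupp K (singular_simplex_set 0 T)"
    by (rule pushforward_finsupp[OF K c face], simp)+
  note p1' = finsupp_smult[OF K p1 m]
  have "retract_simplex T (?d 0 f) = retract_simplex T (?d (Suc 0) f)" if "f \<in> singular_simplex_set (Suc 0) T" for f
  proof -
    have f: "singular_simplex (Suc 0) T f" using that by simp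
    note pc = path_component_of_singular_1_simplex[OF f, of 0 "Suc 0"]
    then have "base_pt T (simplex_pt (?d 0 f)) = base_pt T (simplex_pt (?d (Suc 0) f))"
      using base_pt_eq_iff path_component_in_topspace[OF pc] by fastforce
    then show ?thesis by (simp add: retract_simplex_def)
  qed
  then have eq: "pushforward K (\<lambda>f. retract_simplex T (?d 0 f)) c = pushforward K (\<lambda>f. retract_simplex T (?d (Suc 0) f)) c"
    by (rule pushforward_cong[OF K c])
  have "pushforward K (retract_simplex T) d = (\<lambda>g. pushforward K (\<lambda>f. retract_simplex T (?d (Suc 0) f)) c g \<oplus>\<^bsub>K\<^esub> \<ominus>\<^bsub>K\<^esub> \<one>\<^bsub>K\<^esub> \<otimes>\<^bsub>K\<^esub> pushforward K (\<lambda>f. retract_simplex T (?d (Suc 0) f)) c g)"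
    unfolding d pushforward_add[OF K p0 p1'] pushforward_smult[OF K p1 m] pushforward_pushforward[OF K c] eq ..
  also have "\<dots> = (\<lambda>g. \<zero>\<^bsub>K\<^esub>)"
    using finsupp_closed[OF pushforward_finsupp[OF K c, of "\<lambda>f. retract_simplex T (?d (Suc 0) f)" UNIV]]
    by (simp add: l_minus r_neg)
  finally show "d \<in> ?R"
    using finsupp_add[OF K p0 p1'] by (simp add: d carrier_chain_space)
next
  fix d assume "d \<in> ?R"
  then have d: "d \<in> finsupp K (singular_simplex_set 0 T)" and d0: "pushforward K (retract_simplex T) d = (\<lambda>f. \<zero>\<^bsub>K\<^esub>)"
    by (auto simp: carrier_chain_space)
  have "\<exists>e. singular_simplex (Suc 0) T e \<and> singular_face (Suc 0) 0 e = f \<and> singular_face (Suc 0) (Suc 0) e = retract_simplex T f"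
    if f: "f \<in> singular_simplex_set 0 T" for f
  proof -
    obtain x where x: "x \<in> topspace T" "f = pt_simplex x" using f by (auto simp: singular_simplex_0_iff)
    from singular_1_simplex_path_component_of[OF path_component_of_base_pt[OF x(1)]]
    show ?thesis using x by (metis retract_simplex_pt_simplex)
  qed
  then obtain \<gamma> where \<gamma>: "\<And>f. f \<in> singular_simplex_set 0 T \<Longrightarrow>
     singular_simplex (Suc 0) T (\<gamma> f) \<and> singular_face (Suc 0) 0 (\<gamma> f) = f \<and> singular_face (Suc 0) (Suc 0) (\<gamma> f) = retract_simplex T f"
    by metis
  have c: "pushforward K \<gamma> d \<in> finsupp K (singular_simplex_set (Suc 0) T)"
    by (rule pushforward_finsupp[OF K d]) (use \<gamma> in auto)
  have "pushforward K (singular_face (Suc 0) 0) (pushforward K \<gamma> d) = d"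
    using \<gamma> unfolding pushforward_pushforward[OF K d] by (subst pushforward_cong[OF K d, of _ "\<lambda>f. f"]) (auto simp: pushforward_id[OF K d])
  moreover have "pushforward K (singular_face (Suc 0) (Suc 0)) (pushforward K \<gamma> d) = pushforward K (retract_simplex T) d"
    using \<gamma> unfolding pushforward_pushforward[OF K d] by (intro pushforward_cong[OF K d]) auto
  ultimately have "K_boundary K (Suc 0) (pushforward K \<gamma> d) = d"
    unfolding K_boundary_1[OF K c] using d d0 by simp
  then show "d \<in> K_boundaries K 0 T"
    using c unfolding K_boundaries_def carrier_chain_space by (metis image_eqI)
qed

lemma linear_map_pushforward_retract: "linear_map K (chain_space K 0 T) (chain_space K 0 T) (pushforward K (retract_simplex T))"
  by (rule linear_mapI[OF vectorspace_chain_space[OF K] vectorspace_chain_space[OF K]])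
     (auto simp: carrier_chain_space pushforward_add[OF K] pushforward_smult[OF K] intro: pushforward_finsupp[OF K _ retract_simplex_funcset])

text \<open>
  All 0-chains are cycles, and the boundaries are a kernel, so the results on quotients by kernels
  apply.
\<close>

lemma K_homology_0:
  "K_homology K 0 T = coset_module (chain_space K 0 T) (carrier (chain_space K 0 T))
      {d \<in> carrier (chain_space K 0 T). pushforward K (retract_simplex T) d = \<zero>\<^bsub>chain_space K 0 T\<^esub>}"
  by (simp add: K_homology_def K_cycles_def K_boundary_def flip: K_boundaries_0)

lemma homology_class_kernel_coset:
  "homology_class K T c = {d \<in> carrier (chain_space K 0 T). pushforward K (retract_simplex T) d = \<zero>\<^bsub>chain_space K 0 T\<^esub>} +>\<^bsub>chain_space K 0 T\<^esub> c"
  by (simp add: homology_class_def K_boundaries_0)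

lemma vectorspace_K_homology_0: "vectorspace K (K_homology K 0 T)"
  unfolding K_homology_0 by (rule coset_module_kernel(1)[OF linear_map_pushforward_retract])

lemma linear_map_homology_class: "linear_map K (chain_space K 0 T) (K_homology K 0 T) (homology_class K T)"
  unfolding K_homology_0 homology_class_kernel_coset[abs_def] by (rule coset_module_kernel(2)[OF linear_map_pushforward_retract])

lemma carrier_K_homology_0: "carrier (K_homology K 0 T) = homology_class K T ` carrier (chain_space K 0 T)"
  unfolding K_homology_0 homology_class_kernel_coset[abs_def] by (rule coset_module_kernel(3)[OF linear_map_pushforward_retract])

lemma homology_class_eq_fibre:
  assumes "c \<in> carrier (chain_space K 0 T)"
  shows "homology_class K T c = {d \<in> carrier (chain_space K 0 T). pushforward K (retract_simplex T) d = pushforward K (retract_simplex T) c}"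
  unfolding homology_class_kernel_coset by (rule coset_module_kernel(4)[OF linear_map_pushforward_retract assms])

lemma homology_class_eq_iff:
  assumes "c \<in> carrier (chain_space K 0 T)" "d \<in> carrier (chain_space K 0 T)"
  shows "homology_class K T c = homology_class K T d \<longleftrightarrow> pushforward K (retract_simplex T) c = pushforward K (retract_simplex T) d"
  using assms by (auto simp: homology_class_eq_fibre)

lemma point_mass_pt_simplex_in: "x \<in> topspace T \<Longrightarrow> a \<in> carrier K \<Longrightarrow> point_mass K a (pt_simplex x) \<in> carrier (chain_space K 0 T)"
  unfolding carrier_chain_space by (rule finsupp_point_mass[OF K]) (auto simp: singular_simplex_0_iff)

lemma point_class_in: "x \<in> topspace T \<Longrightarrow> point_class K T x \<in> carrier (K_homology K 0 T)"
  by (simp add: point_class_def carrier_K_homology_0 point_mass_pt_simplex_in)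

lemma point_class_eq_iff:
  assumes x: "x \<in> topspace T" and y: "y \<in> topspace T"
  shows "point_class K T x = point_class K T y \<longleftrightarrow> path_component_of T x y"
proof -
  have "point_class K T x = point_class K T y \<longleftrightarrow> point_mass K \<one>\<^bsub>K\<^esub> (pt_simplex (base_pt T x)) = point_mass K \<one>\<^bsub>K\<^esub> (pt_simplex (base_pt T y))"
    unfolding point_class_def using x y
    by (simp add: homology_class_eq_iff point_mass_pt_simplex_in pushforward_point_mass[OF K])
  also have "\<dots> \<longleftrightarrow> base_pt T x = base_pt T y"
    by (metis one_not_zero pt_simplex_inject point_mass_def)
  finally show ?thesis using base_pt_eq_iff[OF x y] by simp
qed

text \<open>
  Evaluation at a simplex is additive, so sums of chains are computed pointwise.
\<close>

lemma chain_space_finsum_apply: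
  assumes "finite A" "g \<in> A \<rightarrow> carrier (chain_space K p T)"
  shows "(\<Oplus>\<^bsub>chain_space K p T\<^esub>i\<in>A. g i) f = (\<Oplus>\<^bsub>K\<^esub>i\<in>A. g i f)"
proof -
  interpret C: vectorspace K "chain_space K p T" by (rule vectorspace_chain_space[OF K])
  show ?thesis using assms
  proof (induction A rule: finite_induct)
    case empty then show ?case by simp
  next
    case (insert i A)
    then have "g \<in> A \<rightarrow> carrier (chain_space K p T)" "g i \<in> carrier (chain_space K p T)" by auto
    moreover from this have "(\<lambda>i. g i f) \<in> A \<rightarrow> carrier K" "g i f \<in> carrier K"
      by (auto simp: carrier_chain_space Pi_iff)
    ultimately show ?case using insert by simp
  qed
qed

text \<open>
  Every 0-chain is a sum of multiples of points, and passing to classes is linear.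
\<close>

lemma span_point_class: "module.span K (K_homology K 0 T) (point_class K T ` topspace T) = carrier (K_homology K 0 T)"
proof -
  interpret H: vectorspace K "K_homology K 0 T" by (rule vectorspace_K_homology_0)
  interpret h: linear_map K "chain_space K 0 T" "K_homology K 0 T" "homology_class K T" by (rule linear_map_homology_class)
  let ?A = "point_class K T ` topspace T"
  have A: "?A \<subseteq> carrier (K_homology K 0 T)" using point_class_in by auto
  have sub: "LinearCombinations.submodule K (H.span ?A) (K_homology K 0 T)"
    using A by (rule H.span_is_submodule)
  have "homology_class K T c \<in> H.span ?A" if "c \<in> finsupp K (singular_simplex_set 0 T)" for c
    using that
  proof (induction c rule: finsupp_induct[OF K, consumes 1, case_names zero add])
    case zero
    have "homology_class K T \<zero>\<^bsub>chain_space K 0 T\<^esub> = \<zero>\<^bsub>K_homology K 0 T\<^esub>" by (rule h.f0_is_0)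
    then show ?case using sub by (simp add: LinearCombinations.submodule_def)
  next
    case (add c f a)
    then obtain x where x: "x \<in> topspace T" "f = pt_simplex x" by (auto simp: singular_simplex_0_iff)
    let ?s = "point_mass K \<one>\<^bsub>K\<^esub> (pt_simplex x)"
    have s: "?s \<in> carrier (chain_space K 0 T)" using x by (simp add: point_mass_pt_simplex_in)
    have c: "c \<in> carrier (chain_space K 0 T)" using add by (simp add: carrier_chain_space)
    have "(\<lambda>g. c g \<oplus>\<^bsub>K\<^esub> point_mass K a f g) = c \<oplus>\<^bsub>chain_space K 0 T\<^esub> a \<odot>\<^bsub>chain_space K 0 T\<^esub> ?s"
      using add x by (auto simp: point_mass_def fun_eq_iff)
    then have "homology_class K T (\<lambda>g. c g \<oplus>\<^bsub>K\<^esub> point_mass K a f g)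
       = homology_class K T c \<oplus>\<^bsub>K_homology K 0 T\<^esub> a \<odot>\<^bsub>K_homology K 0 T\<^esub> point_class K T x"
      using s c add by (simp add: point_class_def del: chain_space_simps)
    moreover have "point_class K T x \<in> H.span ?A" using H.in_own_span[OF A] x by blast
    ultimately show ?case using sub add by (simp add: LinearCombinations.submodule_def)
  qed
  then have "carrier (K_homology K 0 T) \<subseteq> H.span ?A" by (auto simp: carrier_K_homology_0 carrier_chain_space)
  then show ?thesis using H.span_is_subset2[OF A] by blast
qed

text \<open>
  Every class of a point is represented by a base point. A combination of base points that represents
  zero is killed by the retraction, which also fixes it, so the combination vanishes as a chain and
  its coefficients can be read off.
\<close>

lemma lin_indpt_point_class:
  assumes fin: "finite (point_class K T ` topspace T)"
  shows "\<not> module.lin_dep K (K_homology K 0 T) (point_class K T ` topspace T)"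
proof -
  interpret H: vectorspace K "K_homology K 0 T" by (rule vectorspace_K_homology_0)
  interpret h: linear_map K "chain_space K 0 T" "K_homology K 0 T" "homology_class K T" by (rule linear_map_homology_class)
  interpret r: linear_map K "chain_space K 0 T" "chain_space K 0 T" "pushforward K (retract_simplex T)" by (rule linear_map_pushforward_retract)
  let ?C = "chain_space K 0 T" and ?A = "point_class K T ` topspace T"
  have A: "?A \<subseteq> carrier (K_homology K 0 T)" using point_class_in by auto
  have "\<exists>x. x \<in> topspace T \<and> base_pt T x = x \<and> point_class K T x = S" if S: "S \<in> ?A" for S
  proof -
    obtain y where y: "y \<in> topspace T" "S = point_class K T y" using S by blast
    let ?x = "base_pt T y"
    have "?x \<in> topspace T" "path_component_of T y ?x"
      using y base_pt_in_topspace path_component_of_base_pt by metis+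
    then show ?thesis using y base_pt_eq_iff[of y T ?x] point_class_eq_iff[of y T ?x] by metis
  qed
  then obtain b where b: "\<And>S. S \<in> ?A \<Longrightarrow> b S \<in> topspace T \<and> base_pt T (b S) = b S \<and> point_class K T (b S) = S"
    by metis
  show ?thesis
  proof (rule H.finite_lin_indpt2[OF fin A], intro ballI)
    fix a S assume a: "a \<in> ?A \<rightarrow> carrier K" and zero: "H.lincomb a ?A = \<zero>\<^bsub>K_homology K 0 T\<^esub>" and S: "S \<in> ?A"
    let ?g = "\<lambda>S. a S \<odot>\<^bsub>?C\<^esub> point_mass K \<one>\<^bsub>K\<^esub> (pt_simplex (b S))"
    have s: "point_mass K \<one>\<^bsub>K\<^esub> (pt_simplex (b S)) \<in> carrier ?C" if "S \<in> ?A" for S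
      using b[OF that] by (simp add: point_mass_pt_simplex_in)
    have g: "?g \<in> ?A \<rightarrow> carrier ?C"
      using a s by (auto simp: Pi_iff simp del: chain_space_simps)
    \<comment> \<open>The representative of the given combination that is supported on base points.\<close>
    define d where "d = (\<Oplus>\<^bsub>?C\<^esub>S\<in>?A. ?g S)"
    have d: "d \<in> carrier ?C" unfolding d_def by (rule h.V.module.M.finsum_closed[OF g])
    have "homology_class K T d = (\<Oplus>\<^bsub>K_homology K 0 T\<^esub>S\<in>?A. a S \<odot>\<^bsub>K_homology K 0 T\<^esub> S)"
    proof -
      have "homology_class K T d = (\<Oplus>\<^bsub>K_homology K 0 T\<^esub>S\<in>?A. homology_class K T (?g S))"
        unfolding d_def using linear_map_finsum[OF linear_map_homology_class g] .
      also have "\<dots> = (\<Oplus>\<^bsub>K_homology K 0 T\<^esub>S\<in>?A. a S \<odot>\<^bsub>K_homology K 0 T\<^esub> S)"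
      proof (rule H.module.M.finsum_cong'[OF refl])
        show "(\<lambda>S. a S \<odot>\<^bsub>K_homology K 0 T\<^esub> S) \<in> ?A \<rightarrow> carrier (K_homology K 0 T)"
          using a A by (auto simp: Pi_iff subset_iff)
        fix S assume S: "S \<in> ?A"
        have "homology_class K T (?g S) = a S \<odot>\<^bsub>K_homology K 0 T\<^esub> point_class K T (b S)"
          unfolding point_class_def by (rule h.f_smult) (use a s S in auto)
        then show "homology_class K T (?g S) = a S \<odot>\<^bsub>K_homology K 0 T\<^esub> S" using b[OF S] by simp
      qed
      finally show ?thesis .
    qed
    then have "homology_class K T d = \<zero>\<^bsub>K_homology K 0 T\<^esub>" using zero by (simp add: H.lincomb_def)
    also have "\<dots> = homology_class K T \<zero>\<^bsub>?C\<^esub>" by (rule h.f0_is_0[symmetric])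
    finally have "pushforward K (retract_simplex T) d = \<zero>\<^bsub>?C\<^esub>"
      using homology_class_eq_iff[OF d h.V.module.M.zero_closed] r.f0_is_0 by simp
    moreover have "pushforward K (retract_simplex T) d = d"
    proof -
      have "pushforward K (retract_simplex T) d = (\<Oplus>\<^bsub>?C\<^esub>S\<in>?A. pushforward K (retract_simplex T) (?g S))"
        unfolding d_def using linear_map_finsum[OF linear_map_pushforward_retract g] .
      also have "\<dots> = d"
        unfolding d_def
      proof (rule h.V.module.M.finsum_cong'[OF refl g])
        fix S assume S: "S \<in> ?A"
        have "pushforward K (retract_simplex T) (?g S) = a S \<odot>\<^bsub>?C\<^esub> pushforward K (retract_simplex T) (point_mass K \<one>\<^bsub>K\<^esub> (pt_simplex (b S)))"
          by (rule r.f_smult) (use a s S in auto)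
        then show "pushforward K (retract_simplex T) (?g S) = ?g S" using b[OF S] by (simp add: pushforward_point_mass[OF K])
      qed
      finally show ?thesis .
    qed
    ultimately have "\<zero>\<^bsub>K\<^esub> = d (pt_simplex (b S))" by simp
    also have "\<dots> = (\<Oplus>\<^bsub>K\<^esub>S'\<in>?A. ?g S' (pt_simplex (b S)))"
      unfolding d_def by (rule chain_space_finsum_apply[OF fin g])
    also have "\<dots> = (\<Oplus>\<^bsub>K\<^esub>S'\<in>?A. if S' = S then a S' else \<zero>\<^bsub>K\<^esub>)"
    proof (rule finsum_cong'[OF refl])
      show "(\<lambda>S'. if S' = S then a S' else \<zero>\<^bsub>K\<^esub>) \<in> ?A \<rightarrow> carrier K" using a by auto
      fix S' assume S': "S' \<in> ?A"
      have "b S = b S' \<longleftrightarrow> S = S'" using b[OF S] b[OF S'] by metis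
      then show "?g S' (pt_simplex (b S)) = (if S' = S then a S' else \<zero>\<^bsub>K\<^esub>)"
        using a S' by (auto simp: point_mass_def Pi_iff)
    qed
    also have "\<dots> = a S" using fin a S by (intro add.finprod_singleton_swap) auto
    finally show "a S = \<zero>\<^bsub>K\<^esub>" by simp
  qed
qed

lemma basis_point_class:
  assumes "finite (point_class K T ` topspace T)"
  shows "vectorspace.basis K (K_homology K 0 T) (point_class K T ` topspace T)"
proof -
  interpret H: vectorspace K "K_homology K 0 T" by (rule vectorspace_K_homology_0)
  show ?thesis
    unfolding H.basis_def using lin_indpt_point_class[OF assms] span_point_class point_class_in by auto
qed

text \<open>
  The chain map of an inclusion is the identity on chains, and boundaries in the subspace are boundaries
  in the whole space. Hence the induced map only enlarges the coset.
\<close>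

lemma K_hom_induced_homology_class:
  assumes T: "T = subtopology T' S" and c: "c \<in> carrier (chain_space K 0 T)"
  shows "K_hom_induced K 0 T' (\<lambda>x. x) (homology_class K T c) = homology_class K T' c"
proof -
  interpret r': linear_map K "chain_space K 0 T'" "chain_space K 0 T'" "pushforward K (retract_simplex T')" by (rule linear_map_pushforward_retract)
  interpret r: linear_map K "chain_space K 0 T" "chain_space K 0 T" "pushforward K (retract_simplex T)" by (rule linear_map_pushforward_retract)
  let ?C = "chain_space K 0 T" and ?C' = "chain_space K 0 T'"
  have sub: "carrier (chain_space K p T) \<subseteq> carrier (chain_space K p T')" for p
    by (auto simp: carrier_chain_space T singular_simplex_subtopology intro: finsupp_mono)
  have bnd: "K_boundaries K 0 T \<subseteq> K_boundaries K 0 T'"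
    unfolding K_boundaries_def using sub by blast
  have id: "K_chain_map K 0 (\<lambda>x. x) d = d" if "d \<in> carrier ?C" for d
  proof -
    have d: "d \<in> finsupp K (singular_simplex_set 0 T)" using that by (simp add: carrier_chain_space)
    have "pushforward K (simplex_map 0 (\<lambda>x. x)) d = pushforward K (\<lambda>f. f) d"
      by (rule pushforward_cong[OF K d]) (auto simp: simplex_map_def singular_simplex_def extensional_def restrict_def fun_eq_iff)
    then show ?thesis using pushforward_id[OF K d] by (simp add: K_chain_map_eq_pushforward)
  qed
  have "homology_class K T c \<subseteq> carrier ?C" using homology_class_eq_fibre[OF c] by auto
  then have "K_chain_map K 0 (\<lambda>x. x) ` homology_class K T c = homology_class K T c" using id by force
  then have 1: "K_hom_induced K 0 T' (\<lambda>x. x) (homology_class K T c) = K_boundaries K 0 T' <+>\<^bsub>?C'\<^esub> homology_class K T c"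
    by (simp add: K_hom_induced_def)
  have c': "c \<in> carrier ?C'" using c sub by blast
  show ?thesis unfolding 1
  proof (intro equalityI subsetI)
    fix x assume "x \<in> homology_class K T' c"
    then obtain n where n: "n \<in> K_boundaries K 0 T'" "x = n \<oplus>\<^bsub>?C'\<^esub> c"
      unfolding homology_class_def a_r_coset_def' by blast
    moreover have "c \<in> homology_class K T c" using homology_class_eq_fibre[OF c] c by simp
    ultimately show "x \<in> K_boundaries K 0 T' <+>\<^bsub>?C'\<^esub> homology_class K T c"
      unfolding set_add_def' by blast
  next
    fix x assume "x \<in> K_boundaries K 0 T' <+>\<^bsub>?C'\<^esub> homology_class K T c"
    then obtain n m where n: "n \<in> K_boundaries K 0 T'" and m: "m \<in> K_boundaries K 0 T" and x: "x = n \<oplus>\<^bsub>?C'\<^esub> (m \<oplus>\<^bsub>?C\<^esub> c)"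
      unfolding homology_class_def set_add_def' a_r_coset_def' by blast
    have m': "m \<in> K_boundaries K 0 T'" using m bnd by blast
    have nC: "n \<in> carrier ?C'" "m \<in> carrier ?C'" using n m' K_boundaries_0[of T'] by auto
    have "pushforward K (retract_simplex T') n = \<zero>\<^bsub>?C'\<^esub>" "pushforward K (retract_simplex T') m = \<zero>\<^bsub>?C'\<^esub>"
      using n m' by (auto simp: K_boundaries_0)
    moreover have "x = n \<oplus>\<^bsub>?C'\<^esub> (m \<oplus>\<^bsub>?C'\<^esub> c)" using x by simp
    ultimately have "x \<in> carrier ?C' \<and> pushforward K (retract_simplex T') x = pushforward K (retract_simplex T') c"
      using nC c' by (simp del: chain_space_simps)
    then show "x \<in> homology_class K T' c" using homology_class_eq_fibre[OF c'] by simp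
  qed
qed

end

section \<open>Filtered complexes give component modules\<close>

text \<open>
  The disk is star-shaped about its centre.
\<close>

lemma pathin_cw_disk_ray:
  assumes x: "x \<in> topspace (cw_disk n)"
  shows "pathin (cw_disk n) (\<lambda>t i. t * x i)"
proof -
  have x': "(\<Sum>i<n. x i ^ 2) \<le> 1" "\<And>i. i \<ge> n \<Longrightarrow> x i = 0"
    using x by (auto simp: cw_disk_def topspace_Euclidean_space)
  have "(\<Sum>i<n. (t * x i) ^ 2) \<le> 1" if "t \<in> {0..1}" for t
  proof -
    have "(\<Sum>i<n. (t * x i) ^ 2) = t^2 * (\<Sum>i<n. x i ^ 2)"
      by (simp add: power_mult_distrib sum_distrib_left)
    also have "\<dots> \<le> 1 * 1" using that x' by (intro mult_mono) (auto simp: power_le_one sum_nonneg)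
    finally show ?thesis by simp
  qed
  then show ?thesis
    using x' unfolding pathin_def cw_disk_def Euclidean_space_def
    by (auto simp: continuous_map_in_subtopology continuous_map_componentwise_UNIV intro!: continuous_intros)
qed

text \<open>
  A cell is the image of an open disk, and the rays of the disk are mapped to paths.
\<close>

lemma cell_path_component:
  assumes \<Phi>: "characteristic_map X n e \<Phi>" and x: "x \<in> e" and e: "e \<subseteq> topspace (cw_top X)"
  shows "path_component_of (cw_top X) (\<Phi> (\<lambda>_. 0)) x"
proof -
  have "\<Phi> ` topspace (subtopology (cw_disk n) (cw_disk_interior n)) = topspace (subtopology (cw_top X) e)"
    using \<Phi> homeomorphic_imp_surjective_map unfolding characteristic_map_def by blast
  then have "x \<in> \<Phi> ` topspace (cw_disk n)" using x e by auto
  then obtain y where y: "y \<in> topspace (cw_disk n)" "x = \<Phi> y" by blast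
  have "path_component_of (cw_disk n) (\<lambda>_. 0) y"
    unfolding path_component_of_def using pathin_cw_disk_ray[OF y(1)]
    by (intro exI[of _ "\<lambda>t i. t * y i"] conjI) auto
  then show ?thesis
    using \<Phi> y path_component_of_continuous_image unfolding characteristic_map_def by fast
qed

context
  fixes K :: "('k, 'm) ring_scheme"
  assumes K: "field K"
begin

lemma finite_point_class:
  assumes X: "finite_cw_complex X"
  shows "finite (point_class K (cw_top X) ` topspace (cw_top X))"
proof -
  let ?T = "cw_top X"
  have cov: "\<Union>(snd ` cw_cells X) = topspace ?T"
    and ch: "\<And>n e. (n, e) \<in> cw_cells X \<Longrightarrow> \<exists>\<Phi>. characteristic_map X n e \<Phi>"
    and fin: "finite (cw_cells X)"
    using X by (auto simp: finite_cw_complex_def cw_complex_def)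
  have "finite (point_class K ?T ` e)" if c: "(n, e) \<in> cw_cells X" for n e
  proof -
    obtain \<Phi> where \<Phi>: "characteristic_map X n e \<Phi>" using ch[OF c] by blast
    have e: "e \<subseteq> topspace ?T" using cov c by force
    have "point_class K ?T x = point_class K ?T (\<Phi> (\<lambda>_. 0))" if "x \<in> e" for x
      using cell_path_component[OF \<Phi> that e] path_component_in_topspace point_class_eq_iff[OF K] by metis
    then have "point_class K ?T ` e \<subseteq> {point_class K ?T (\<Phi> (\<lambda>_. 0))}" by blast
    then show ?thesis using finite_subset by blast
  qed
  then have "finite (\<Union>c\<in>cw_cells X. point_class K ?T ` snd c)" using fin by auto
  then show ?thesis by (simp add: image_UN flip: cov)
qed

lemma linear_map_K_hom_induced:
  assumes T: "T = subtopology T' S"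
  shows "linear_map K (K_homology K 0 T) (K_homology K 0 T') (K_hom_induced K 0 T' (\<lambda>x. x))"
proof -
  interpret h: linear_map K "chain_space K 0 T" "K_homology K 0 T" "homology_class K T" by (rule linear_map_homology_class[OF K])
  interpret h': linear_map K "chain_space K 0 T'" "K_homology K 0 T'" "homology_class K T'" by (rule linear_map_homology_class[OF K])
  note ind = K_hom_induced_homology_class[OF K T]
  have sub: "c \<in> carrier (chain_space K 0 T')" if "c \<in> carrier (chain_space K 0 T)" for c
    using that by (auto simp: carrier_chain_space T singular_simplex_subtopology intro: finsupp_mono)
  show ?thesis
  proof (rule linear_mapI[OF h.W.vectorspace_axioms h'.W.vectorspace_axioms])
    show "K_hom_induced K 0 T' (\<lambda>x. x) \<in> carrier (K_homology K 0 T) \<rightarrow> carrier (K_homology K 0 T')"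
      using sub by (auto simp: carrier_K_homology_0[OF K] ind)
    fix v w assume "v \<in> carrier (K_homology K 0 T)" "w \<in> carrier (K_homology K 0 T)"
    then obtain c d where c: "c \<in> carrier (chain_space K 0 T)" "v = homology_class K T c"
      and d: "d \<in> carrier (chain_space K 0 T)" "w = homology_class K T d"
      by (auto simp: carrier_K_homology_0[OF K])
    have "v \<oplus>\<^bsub>K_homology K 0 T\<^esub> w = homology_class K T (c \<oplus>\<^bsub>chain_space K 0 T\<^esub> d)"
      using c d by (simp del: chain_space_simps)
    moreover have "homology_class K T' c \<oplus>\<^bsub>K_homology K 0 T'\<^esub> homology_class K T' d = homology_class K T' (c \<oplus>\<^bsub>chain_space K 0 T'\<^esub> d)"
      using c d sub by (simp del: chain_space_simps)
    moreover have "c \<oplus>\<^bsub>chain_space K 0 T\<^esub> d \<in> carrier (chain_space K 0 T)"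
      using c d h.V.module.M.add.m_closed by (simp del: chain_space_simps)
    ultimately show "K_hom_induced K 0 T' (\<lambda>x. x) (v \<oplus>\<^bsub>K_homology K 0 T\<^esub> w)
       = K_hom_induced K 0 T' (\<lambda>x. x) v \<oplus>\<^bsub>K_homology K 0 T'\<^esub> K_hom_induced K 0 T' (\<lambda>x. x) w"
      using c d by (simp add: ind)
  next
    fix a v assume a: "a \<in> carrier K" and "v \<in> carrier (K_homology K 0 T)"
    then obtain c where c: "c \<in> carrier (chain_space K 0 T)" "v = homology_class K T c"
      by (auto simp: carrier_K_homology_0[OF K])
    have "a \<odot>\<^bsub>K_homology K 0 T\<^esub> v = homology_class K T (a \<odot>\<^bsub>chain_space K 0 T\<^esub> c)"
      using a c by (simp del: chain_space_simps)
    moreover have "a \<odot>\<^bsub>K_homology K 0 T'\<^esub> homology_class K T' c = homology_class K T' (a \<odot>\<^bsub>chain_space K 0 T'\<^esub> c)"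
      using a c sub by (simp del: chain_space_simps)
    moreover have "a \<odot>\<^bsub>chain_space K 0 T\<^esub> c \<in> carrier (chain_space K 0 T)"
      using a c by (simp del: chain_space_simps)
    ultimately show "K_hom_induced K 0 T' (\<lambda>x. x) (a \<odot>\<^bsub>K_homology K 0 T\<^esub> v)
       = a \<odot>\<^bsub>K_homology K 0 T'\<^esub> K_hom_induced K 0 T' (\<lambda>x. x) v"
      using a c by (simp add: ind)
  qed
qed

lemma K_hom_induced_point_class:
  assumes "T = subtopology T' S" "x \<in> topspace T"
  shows "K_hom_induced K 0 T' (\<lambda>x. x) (point_class K T x) = point_class K T' x"
proof -
  interpret field K by (fact K)
  show ?thesis unfolding point_class_def
    by (rule K_hom_induced_homology_class[OF K assms(1) point_mass_pt_simplex_in[OF K assms(2)]]) simp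
qed

lemma persistence_module_homology_0:
  assumes X: "finite_filtered_cw_complex P X"
  shows "persistence_module K P (homology_pers_module K 0 X)"
proof -
  have fin: "finite (point_class K (cw_top (X q)) ` topspace (cw_top (X q)))" if "q \<in> P" for q
    using X that finite_point_class by (auto simp: finite_filtered_cw_complex_def)
  have sub: "\<exists>S. cw_top (X q) = subtopology (cw_top (X p)) S" if "q \<in> P" "p \<in> P" "q \<le> p" for q p
    using X that unfolding finite_filtered_cw_complex_def filtered_cw_complex_def cw_subcomplex_def by blast
  have ind: "K_hom_induced K 0 (cw_top (X p)) (\<lambda>x. x) (homology_class K (cw_top (X q)) c) = homology_class K (cw_top (X p)) c
      \<and> c \<in> carrier (chain_space K 0 (cw_top (X p)))"
    if c: "c \<in> carrier (chain_space K 0 (cw_top (X q)))" and qp: "q \<in> P" "p \<in> P" "q \<le> p" for q p c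
  proof -
    obtain S where S: "cw_top (X q) = subtopology (cw_top (X p)) S" using sub[OF qp] by blast
    show ?thesis using K_hom_induced_homology_class[OF K S c] c
      by (auto simp: carrier_chain_space S singular_simplex_subtopology intro: finsupp_mono)
  qed
  have lin: "linear_map K (K_homology K 0 (cw_top (X q))) (K_homology K 0 (cw_top (X p)))
      (K_hom_induced K 0 (cw_top (X p)) (\<lambda>x. x))" if "q \<in> P" "p \<in> P" "q \<le> p" for q p
    using sub[OF that] linear_map_K_hom_induced by blast
  have dim: "vectorspace.fin_dim K (K_homology K 0 (cw_top (X q)))" if q: "q \<in> P" for q
  proof -
    interpret H: vectorspace K "K_homology K 0 (cw_top (X q))" by (rule vectorspace_K_homology_0[OF K])
    show ?thesis unfolding H.fin_dim_def using fin[OF q] basis_point_class[OF K fin[OF q]] unfolding H.basis_def by blast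
  qed
  show ?thesis
    unfolding persistence_module_def homology_pers_module_def pers_module.simps
    using lin dim ind by (auto simp: vectorspace_K_homology_0[OF K] carrier_K_homology_0[OF K])
qed

text \<open>
  The bases of all classes of points are carried into one another, since an inclusion preserves the
  class of a point. They are finite, and with \<open>P\<close> finite there are only finitely many basis elements
  altogether, let alone generators.
\<close>

lemma homology_0_fin_gen_component_module:
  assumes X: "finite_filtered_cw_complex P X" and P: "finite P"
  shows "fin_gen_component_module K P (homology_pers_module K 0 X)"
proof -
  let ?M = "homology_pers_module K 0 X" and ?T = "\<lambda>q. cw_top (X q)"
  let ?B = "\<lambda>q. point_class K (?T q) ` topspace (?T q)"
  have fin: "finite (?B q)" if "q \<in> P" for q
    using X that finite_point_class by (auto simp: finite_filtered_cw_complex_def)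
  note pm = persistence_module_homology_0[OF X]
  have B: "component_basis K P ?M ?B"
    unfolding component_basis_iff[OF pm]
  proof (intro conjI ballI impI)
    fix q assume "q \<in> P"
    then show "vectorspace.basis K (pm_obj ?M q) (?B q)"
      using basis_point_class[OF K fin] by (simp add: homology_pers_module_def)
  next
    fix q p assume qp: "q \<in> P" "p \<in> P" "q \<le> p"
    then obtain S where S: "?T q = subtopology (?T p) S"
      using X unfolding finite_filtered_cw_complex_def filtered_cw_complex_def cw_subcomplex_def by blast
    then have "topspace (?T q) \<subseteq> topspace (?T p)" by simp
    then show "pm_mor ?M q p ` ?B q \<subseteq> ?B p"
      using K_hom_induced_point_class[OF S] by (auto simp: homology_pers_module_def)
  qed
  have "generators P ?M ?B \<subseteq> Sigma P ?B" by (auto simp: generators_def)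
  then have "finite (generators P ?M ?B)" using P fin finite_SigmaI finite_subset by meson
  then show ?thesis unfolding fin_gen_component_module_def component_module_def using pm B by blast
qed

end

section \<open>Finite graphs as CW-complexes\<close>

text \<open>
  Graphs are embedded in the real sequence space, with the vertices as unit vectors and the edges as
  straight segments. A point then determines the open cell that contains it through its support, and
  the barycentric coordinates give continuous functions on the graph.
\<close>

definition vertex :: "nat \<Rightarrow> nat \<Rightarrow> real" where
  "vertex v = (\<lambda>i. if i = v then 1 else 0)"

definition edge_point :: "nat \<Rightarrow> nat \<Rightarrow> real \<Rightarrow> nat \<Rightarrow> real" where
  "edge_point v w t = (\<lambda>i. if i = v then 1 - t else if i = w then t else 0)"

definition open_edge :: "nat \<Rightarrow> nat \<Rightarrow> (nat \<Rightarrow> real) set" where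
  "open_edge v w = edge_point v w ` {0<..<1}"

definition graph_cells :: "nat set \<Rightarrow> (nat \<times> nat) set \<Rightarrow> (nat \<times> (nat \<Rightarrow> real) set) set" where
  "graph_cells V E = (\<lambda>v. (0, {vertex v})) ` V \<union> (\<lambda>(v, w). (1, open_edge v w)) ` E"

definition graph_cw :: "nat set \<Rightarrow> (nat \<times> nat) set \<Rightarrow> (nat \<Rightarrow> real) cw_data" where
  "graph_cw V E = \<lparr>cw_top = subtopology (powertop_real UNIV) (\<Union>(snd ` graph_cells V E)), cw_cells = graph_cells V E\<rparr>"

lemma edge_point_0 [simp]: "edge_point v w 0 = vertex v" by (auto simp: edge_point_def vertex_def)
lemma edge_point_1: "v \<noteq> w \<Longrightarrow> edge_point v w 1 = vertex w" by (auto simp: edge_point_def vertex_def)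

lemma closed_edge: "v \<noteq> w \<Longrightarrow> edge_point v w ` {0..1} = open_edge v w \<union> {vertex v, vertex w}"
proof -
  assume "v \<noteq> w"
  have "{0..1} = {0<..<1} \<union> {0, 1::real}" by auto
  then show ?thesis using edge_point_1[OF \<open>v \<noteq> w\<close>] by (auto simp: open_edge_def)
qed

lemma continuous_edge_point: "continuous_map (top_of_set {0..1}) (powertop_real UNIV) (edge_point v w)"
  unfolding continuous_map_componentwise_UNIV edge_point_def
proof
  fix i
  consider "i = v" | "i \<noteq> v" "i = w" | "i \<noteq> v" "i \<noteq> w" by blast
  then show "continuous_map (top_of_set {0..1}) euclideanreal (\<lambda>t. if i = v then 1 - t else if i = w then t else 0)"
    by cases (auto intro!: continuous_intros)
qed

lemma Hausdorff_powertop_real: "Hausdorff_space (powertop_real UNIV)"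
  by (simp add: Hausdorff_space_product_topology)

lemma closedin_closed_edge: "closedin (powertop_real UNIV) (edge_point v w ` {0..1})"
proof (rule compactin_imp_closedin[OF Hausdorff_powertop_real])
  show "compactin (powertop_real UNIV) (edge_point v w ` {0..1})"
    by (rule image_compactin[OF _ continuous_edge_point]) (simp add: compactin_subtopology)
qed

text \<open>
  The closed edge is compact, hence closed in the ambient Hausdorff space.
\<close>

lemma closure_of_open_edge:
  assumes "v \<noteq> w"
  shows "(subtopology (powertop_real UNIV) S) closure_of open_edge v w \<subseteq> open_edge v w \<union> {vertex v, vertex w}"
proof -
  have "powertop_real UNIV closure_of open_edge v w \<subseteq> edge_point v w ` {0..1}"
    by (rule closure_of_minimal[OF _ closedin_closed_edge]) (auto simp: open_edge_def)
  then show ?thesis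
    unfolding closed_edge[OF assms, symmetric] by (rule order_trans[OF closure_of_subtopology_subset])
qed

lemma closure_of_vertex:
  "(subtopology (powertop_real UNIV) S) closure_of {vertex v} \<subseteq> {vertex v}"
proof -
  have "closedin (powertop_real UNIV) {vertex v}"
    by (rule closedin_Hausdorff_sing_eq[OF Hausdorff_powertop_real, THEN iffD2]) simp
  then have "powertop_real UNIV closure_of {vertex v} = {vertex v}" by (simp add: closure_of_eq)
  then show ?thesis using order_trans[OF closure_of_subtopology_subset] by (metis order_refl)
qed

text \<open>
  Finitely many cells cover the space, so a set is the finite union of its traces on the closed cells.
\<close>

lemma finite_weak_topology:
  assumes fin: "finite C" and cov: "topspace T \<subseteq> \<Union>(snd ` C)" and A: "A \<subseteq> topspace T"
  shows "closedin T A \<longleftrightarrow> (\<forall>(n, e)\<in>C. closedin T (A \<inter> (T closure_of e)))"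
proof
  assume "\<forall>(n, e)\<in>C. closedin T (A \<inter> (T closure_of e))"
  then have "closedin T (\<Union>c\<in>C. A \<inter> (T closure_of (snd c)))"
    using fin by (intro closedin_Union) auto
  moreover have "A = (\<Union>c\<in>C. A \<inter> (T closure_of (snd c)))"
  proof -
    have "x \<in> (\<Union>c\<in>C. A \<inter> (T closure_of (snd c)))" if x: "x \<in> A" for x
    proof -
      obtain c where "c \<in> C" "x \<in> snd c" using cov A x by blast
      then show ?thesis using x A closure_of_subset_Int[of T "snd c"] by blast
    qed
    then show ?thesis by blast
  qed
  ultimately show "closedin T A" by simp
qed (auto intro: closedin_Int)

lemma characteristic_map_vertex:
  assumes v: "vertex v \<in> topspace (cw_top X)"
  shows "characteristic_map X 0 {vertex v} (\<lambda>_. vertex v)"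
proof -
  have D: "topspace (cw_disk 0) = {\<lambda>_. 0}" "cw_disk_interior 0 = {\<lambda>_. 0}" "cw_disk_boundary 0 = {}"
    by (auto simp: cw_disk_def topspace_Euclidean_space cw_disk_interior_def cw_disk_boundary_def fun_eq_iff)
  have "homeomorphic_maps (subtopology (cw_disk 0) (cw_disk_interior 0)) (subtopology (cw_top X) {vertex v})
      (\<lambda>_. vertex v) (\<lambda>_. (\<lambda>_. 0))"
    unfolding homeomorphic_maps_def using v by (auto simp: D)
  then have "homeomorphic_map (subtopology (cw_disk 0) (cw_disk_interior 0)) (subtopology (cw_top X) {vertex v}) (\<lambda>_. vertex v)"
    using homeomorphic_map_maps by blast
  then show ?thesis unfolding characteristic_map_def using v by (auto simp: D intro: exI[of _ "{}"])
qed

text \<open>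
  The disk of dimension 1 is the interval from -1 to 1, which is rescaled to the unit interval. The
  inverse on the open edge is read off from the coordinate at \<open>w\<close>.
\<close>

lemma characteristic_map_edge:
  assumes T: "cw_top X = subtopology (powertop_real UNIV) S" and e: "edge_point v w ` {0..1} \<subseteq> S" and vw: "v \<noteq> w"
    and cells: "(0, {vertex v}) \<in> cw_cells X" "(0, {vertex w}) \<in> cw_cells X"
  shows "characteristic_map X 1 (open_edge v w) (\<lambda>x. edge_point v w ((1 + x 0) / 2))"  (is "characteristic_map X 1 _ ?\<Phi>")
proof -
  let ?g = "\<lambda>y i::nat. if i = 0 then 2 * y w - 1 else (0::real)"
  have D: "topspace (cw_disk 1) = {x. (\<forall>i\<ge>1. x i = 0) \<and> \<bar>x 0\<bar> \<le> 1}"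
    "cw_disk_interior 1 = {x. (\<forall>i\<ge>1. x i = 0) \<and> \<bar>x 0\<bar> < 1}"
    "cw_disk_boundary 1 = {x. (\<forall>i\<ge>1. x i = 0) \<and> \<bar>x 0\<bar> = 1}"
    using abs_square_le_1 abs_square_less_1 abs_square_eq_1
    by (auto simp: cw_disk_def topspace_Euclidean_space cw_disk_interior_def cw_disk_boundary_def)
  have T0: "cw_disk 1 = subtopology (powertop_real UNIV) {x. (\<forall>i\<ge>1. x i = 0) \<and> \<bar>x 0\<bar> \<le> 1}"
    using D(1) unfolding cw_disk_def Euclidean_space_def subtopology_subtopology by simp
  have c0: "continuous_map (subtopology (powertop_real UNIV) Z) euclideanreal (\<lambda>x. x i)" for Z and i :: nat
    by (intro continuous_map_from_subtopology continuous_map_product_projection) simp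
  have cseg: "continuous_map (subtopology (powertop_real UNIV) Z) (powertop_real UNIV) ?\<Phi>" for Z
    unfolding continuous_map_componentwise_UNIV edge_point_def
  proof
    fix i
    consider "i = v" | "i \<noteq> v" "i = w" | "i \<noteq> v" "i \<noteq> w" by blast
    then show "continuous_map (subtopology (powertop_real UNIV) Z) euclideanreal
       (\<lambda>x. if i = v then 1 - (1 + x 0) / 2 else if i = w then (1 + x 0) / 2 else 0)"
      by cases (auto intro!: continuous_intros c0)
  qed
  have im: "?\<Phi> x \<in> edge_point v w ` {0..1}" if "\<bar>x 0\<bar> \<le> 1" for x :: "nat \<Rightarrow> real"
    using that by (intro imageI) (auto simp: abs_le_iff)
  then have imS: "?\<Phi> x \<in> S" if "\<bar>x 0\<bar> \<le> 1" for x :: "nat \<Rightarrow> real"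
    using that e by blast
  have cont: "continuous_map (cw_disk 1) (cw_top X) ?\<Phi>"
    unfolding T T0 continuous_map_in_subtopology using cseg imS by (auto simp: image_subset_iff)
  have oS: "open_edge v w \<subseteq> S" using e by (auto simp: open_edge_def)
  have int: "?\<Phi> x \<in> open_edge v w" if "\<bar>x 0\<bar> < 1" for x :: "nat \<Rightarrow> real"
    unfolding open_edge_def using that by (intro imageI) (auto simp: abs_less_iff)
  have cg: "continuous_map (subtopology (powertop_real UNIV) Z) (powertop_real UNIV) ?g" for Z
    unfolding continuous_map_componentwise_UNIV
  proof
    fix i :: nat
    show "continuous_map (subtopology (powertop_real UNIV) Z) euclideanreal (\<lambda>y. if i = 0 then 2 * y w - 1 else 0)"
      by (cases "i = 0") (auto intro!: continuous_intros c0)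
  qed
  have g: "\<bar>?g y 0\<bar> < 1 \<and> ?\<Phi> (?g y) = y" if "y \<in> open_edge v w" for y
    using that vw by (auto simp: open_edge_def edge_point_def fun_eq_iff abs_less_iff)
  have gP: "?g (?\<Phi> x) = x" if "\<forall>i\<ge>1. x i = 0" for x :: "nat \<Rightarrow> real"
    using that vw by (auto simp: edge_point_def fun_eq_iff add_divide_distrib)
  have "homeomorphic_maps (subtopology (cw_disk 1) (cw_disk_interior 1)) (subtopology (cw_top X) (open_edge v w)) ?\<Phi> ?g"
    unfolding homeomorphic_maps_def T T0 subtopology_subtopology
  proof (intro conjI ballI)
    show "continuous_map (subtopology (powertop_real UNIV) ({x. (\<forall>i\<ge>1. x i = 0) \<and> \<bar>x 0\<bar> \<le> 1} \<inter> cw_disk_interior 1))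
       (subtopology (powertop_real UNIV) (S \<inter> open_edge v w)) ?\<Phi>"
      unfolding continuous_map_in_subtopology D using cseg int oS by (simp add: Pi_iff subset_iff)
    show "continuous_map (subtopology (powertop_real UNIV) (S \<inter> open_edge v w))
       (subtopology (powertop_real UNIV) ({x. (\<forall>i\<ge>1. x i = 0) \<and> \<bar>x 0\<bar> \<le> 1} \<inter> cw_disk_interior 1)) ?g"
      unfolding continuous_map_in_subtopology D using cg g by (simp add: Pi_iff less_imp_le)
  qed (use g gP in \<open>auto simp: D[unfolded One_nat_def]\<close>)
  then have hom: "homeomorphic_map (subtopology (cw_disk 1) (cw_disk_interior 1)) (subtopology (cw_top X) (open_edge v w)) ?\<Phi>"
    using homeomorphic_map_maps by blast
  have bd: "?\<Phi> ` cw_disk_boundary 1 \<subseteq> \<Union>(snd ` {(0, {vertex v}), (0, {vertex w})})"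
    unfolding D using edge_point_1[OF vw] by (auto simp: abs_eq_iff')
  have F: "finite {(0, {vertex v}), (0, {vertex w})} \<and>
      {(0, {vertex v}), (0, {vertex w})} \<subseteq> {(m, d). (m, d) \<in> cw_cells X \<and> m < 1}"
    using cells by simp
  show ?thesis unfolding characteristic_map_def
    using cont hom bd F by blast
qed

text \<open>
  If both orientations of an edge occur in \<open>E\<close>, they therefore contribute the same cell.
\<close>

lemma open_edge_commute:
  assumes "v \<noteq> w"
  shows "open_edge w v = open_edge v w"
proof -
  have "open_edge a b \<subseteq> open_edge b a" if "a \<noteq> b" for a b
    unfolding open_edge_def
  proof (rule image_subsetI)
    fix t :: real assume "t \<in> {0<..<1}"
    then show "edge_point a b t \<in> edge_point b a ` {0<..<1}"
      using that by (intro image_eqI[of _ _ "1 - t"]) (auto simp: edge_point_def)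
  qed
  then show ?thesis using assms by (intro equalityI) auto
qed

lemma support_vertex: "{i. vertex v i \<noteq> 0} = {v}" by (auto simp: vertex_def)

lemma support_open_edge: "x \<in> open_edge v w \<Longrightarrow> {i. x i \<noteq> 0} = {v, w}"
  by (auto simp: open_edge_def edge_point_def split: if_splits)

lemma topspace_graph_cw:
  "topspace (cw_top (graph_cw V E)) = vertex ` V \<union> (\<Union>(v, w)\<in>E. open_edge v w)"
  by (auto simp: graph_cw_def graph_cells_def)

lemma cw_top_graph_cw:
  "cw_top (graph_cw V E) = subtopology (powertop_real UNIV) (vertex ` V \<union> (\<Union>(v, w)\<in>E. open_edge v w))"
proof -
  have "\<Union>(snd ` graph_cells V E) = vertex ` V \<union> (\<Union>(v, w)\<in>E. open_edge v w)"
    by (auto simp: graph_cells_def)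
  then show ?thesis by (simp add: graph_cw_def)
qed

locale finite_graph =
  fixes V :: "nat set" and E :: "(nat \<times> nat) set"
  assumes finite_V: "finite V" and edges_subset: "E \<subseteq> V \<times> V" and loop_free: "(v, w) \<in> E \<Longrightarrow> v \<noteq> w"
begin

abbreviation "G \<equiv> graph_cw V E"

lemma edge_subset:
  assumes e: "(v, w) \<in> E"
  shows "edge_point v w ` {0..1} \<subseteq> vertex ` V \<union> (\<Union>(v, w)\<in>E. open_edge v w)"
  using e edges_subset unfolding closed_edge[OF loop_free[OF e]] by auto

text \<open>
  The support of a common point has one element in a vertex cell and two in an edge cell, and it
  determines the cell.
\<close>

lemma disjoint_cells:
  assumes "(m, d) \<in> graph_cells V E" "(n, e) \<in> graph_cells V E" "x \<in> d" "x \<in> e"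
  shows "(m, d) = (n, e)"
proof -
  \<comment> \<open>The cell can be reconstructed from the support of \<open>x\<close>.\<close>
  have cell: "(\<exists>v. {i. x i \<noteq> 0} = {v} \<and> c = (0, {vertex v})) \<or>
    (\<exists>v w. v \<noteq> w \<and> {i. x i \<noteq> 0} = {v, w} \<and> c = (1, open_edge v w))"
    if "c \<in> graph_cells V E" "x \<in> snd c" for c
  proof -
    consider v where "c = (0, {vertex v})" | v w where "(v, w) \<in> E" "c = (1, open_edge v w)"
      using \<open>c \<in> graph_cells V E\<close> by (auto simp: graph_cells_def)
    then show ?thesis
    proof cases
      case 1
      then have "x = vertex v" using that by simp
      then have "{i. x i \<noteq> 0} = {v} \<and> c = (0, {vertex v})" using 1 support_vertex by simp
      then show ?thesis by (intro disjI1 exI)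
    next
      case 2
      then have "{i. x i \<noteq> 0} = {v, w}" using that support_open_edge by simp
      then have "v \<noteq> w \<and> {i. x i \<noteq> 0} = {v, w} \<and> c = (1, open_edge v w)"
        using 2(2) loop_free[OF 2(1)] by simp
      then show ?thesis by (intro disjI2 exI)
    qed
  qed
  have x: "x \<in> snd (m, d)" "x \<in> snd (n, e)" using assms by simp_all
  from cell[OF assms(1) x(1)] cell[OF assms(2) x(2)] show ?thesis
  proof (elim disjE exE conjE)
    fix v w v' w' assume *: "{i. x i \<noteq> 0} = {v, w}" "{i. x i \<noteq> 0} = {v', w'}" "v \<noteq> w"
      and c: "(m, d) = (1, open_edge v w)" "(n, e) = (1, open_edge v' w')"
    then have "v = v' \<and> w = w' \<or> v = w' \<and> w = v'" by (metis doubleton_eq_iff)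
    then show ?thesis using c open_edge_commute[OF *(3)] by auto
  next
    fix v v' assume "{i. x i \<noteq> 0} = {v}" "{i. x i \<noteq> 0} = {v'}"
      and c: "(m, d) = (0, {vertex v})" "(n, e) = (0, {vertex v'})"
    then have "v = v'" by simp
    then show ?thesis using c by simp
  next
    fix v v' w assume "{i. x i \<noteq> 0} = {v}" "{i. x i \<noteq> 0} = {v', w}" "v' \<noteq> w"
    then have False by (metis doubleton_eq_iff insert_absorb2)
    then show ?thesis ..
  next
    fix v v' w assume "{i. x i \<noteq> 0} = {v'}" "{i. x i \<noteq> 0} = {v, w}" "v \<noteq> w"
    then have False by (metis doubleton_eq_iff insert_absorb2)
    then show ?thesis ..
  qed
qed

lemma finite_cw_complex_graph: "finite_cw_complex G"
proof -
  have fin: "finite (graph_cells V E)"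
    using finite_V edges_subset finite_subset[of E "V \<times> V"] by (simp add: graph_cells_def)
  have ch: "\<exists>\<Phi>. characteristic_map G n e \<Phi>" if c: "(n, e) \<in> graph_cells V E" for n e
  proof -
    consider v where "v \<in> V" "n = 0" "e = {vertex v}" | v w where "(v, w) \<in> E" "n = 1" "e = open_edge v w"
      using c by (auto simp: graph_cells_def)
    then show ?thesis
    proof cases
      case 1
      then have "vertex v \<in> topspace (cw_top G)" by (simp add: topspace_graph_cw)
      then show ?thesis using characteristic_map_vertex 1 by blast
    next
      case 2
      have "(0, {vertex v}) \<in> cw_cells G" "(0, {vertex w}) \<in> cw_cells G"
        using 2 edges_subset by (auto simp: graph_cw_def graph_cells_def)
      then show ?thesis
        using characteristic_map_edge[OF cw_top_graph_cw edge_subset[OF 2(1)] loop_free[OF 2(1)]] 2 by blast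
    qed
  qed
  have top: "topspace (cw_top G) = \<Union>(snd ` graph_cells V E)" by (simp add: graph_cw_def)
  have haus: "Hausdorff_space (cw_top G)"
    by (simp add: graph_cw_def Hausdorff_space_subtopology Hausdorff_powertop_real)
  have cells: "cw_cells G = graph_cells V E" by (simp add: graph_cw_def)
  show ?thesis
    unfolding finite_cw_complex_def cw_complex_def cells
  proof (intro conjI allI impI)
    show "\<forall>(m, d)\<in>graph_cells V E. \<forall>(n, e)\<in>graph_cells V E. (m, d) \<noteq> (n, e) \<longrightarrow> d \<inter> e = {}"
      using disjoint_cells by fast
    show "\<forall>(n, e)\<in>graph_cells V E. \<exists>\<Phi>. characteristic_map G n e \<Phi>" using ch by blast
    fix A assume A: "A \<subseteq> topspace (cw_top G)"
    show "closedin (cw_top G) A \<longleftrightarrow> (\<forall>(n, e)\<in>graph_cells V E. closedin (cw_top G) (A \<inter> (cw_top G closure_of e)))"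
      by (rule finite_weak_topology[OF fin _ A]) (simp add: top)
  qed (use haus top fin in auto)
qed

lemma cw_subcomplex_graph:
  assumes "V' \<subseteq> V" "E' \<subseteq> E" "E' \<subseteq> V' \<times> V'"
  shows "cw_subcomplex (graph_cw V' E') G"
  unfolding cw_subcomplex_def
proof (intro conjI)
  let ?S = "\<lambda>V E. vertex ` V \<union> (\<Union>(v, w)\<in>E. open_edge v w)"
  have S: "\<Union>(snd ` cw_cells (graph_cw V' E')) = ?S V' E'" for V' E'
    by (auto simp: graph_cw_def graph_cells_def)
  show "cw_cells (graph_cw V' E') \<subseteq> cw_cells G"
    using assms by (auto simp: graph_cw_def graph_cells_def)
  have "?S V' E' \<subseteq> ?S V E" using assms by blast
  then show "cw_top (graph_cw V' E') = subtopology (cw_top G) (\<Union>(snd ` cw_cells (graph_cw V' E')))"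
    unfolding S cw_top_graph_cw subtopology_subtopology by (metis inf.absorb2)
  show "\<forall>(n, e)\<in>cw_cells (graph_cw V' E'). cw_top G closure_of e \<subseteq> \<Union>(snd ` cw_cells (graph_cw V' E'))"
  proof (intro ballI, clarify)
    fix n e x assume c: "(n, e) \<in> cw_cells (graph_cw V' E')" and x: "x \<in> cw_top G closure_of e"
    have "x \<in> ?S V' E'"
    proof -
      consider v where "v \<in> V'" "e = {vertex v}" | v w where "(v, w) \<in> E'" "e = open_edge v w"
        using c by (auto simp: graph_cw_def graph_cells_def)
      then show ?thesis
      proof cases
        case 1 then show ?thesis using x closure_of_vertex unfolding cw_top_graph_cw by blast
      next
        case 2
        then have "v \<noteq> w" using loop_free assms by blast
        then have "x \<in> open_edge v w \<union> {vertex v, vertex w}"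
          using x closure_of_open_edge 2 unfolding cw_top_graph_cw by blast
        then show ?thesis using 2 assms by blast
      qed
    qed
    then show "x \<in> \<Union>(snd ` cw_cells (graph_cw V' E'))" using S by simp
  qed
qed

lemma path_component_of_closed_edge:
  assumes e: "(v, w) \<in> E" and x: "x \<in> edge_point v w ` {0..1}" and y: "y \<in> edge_point v w ` {0..1}"
  shows "path_component_of (cw_top G) x y"
proof -
  have "pathin (cw_top G) (edge_point v w)"
    unfolding pathin_def cw_top_graph_cw continuous_map_in_subtopology
    using continuous_edge_point edge_subset[OF e] by (auto simp: image_subset_iff)
  then have "path_connectedin (cw_top G) (edge_point v w ` {0..1})" by (rule path_connectedin_path_image)
  then show ?thesis using x y by (intro path_component_of[THEN iffD2]) blast
qed

lemma path_component_of_edge: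
  assumes e: "(v, w) \<in> E"
  shows "path_component_of (cw_top G) (vertex v) (vertex w)"
  by (rule path_component_of_closed_edge[OF e]) (auto simp: closed_edge[OF loop_free[OF e]])

lemma path_component_of_some_vertex:
  assumes x: "x \<in> topspace (cw_top G)"
  obtains v where "v \<in> V" "path_component_of (cw_top G) x (vertex v)"
proof -
  consider v where "v \<in> V" "x = vertex v" | v w where "(v, w) \<in> E" "x \<in> open_edge v w"
    using x by (auto simp: topspace_graph_cw)
  then show thesis
  proof cases
    case 1 then show thesis using that x by (metis path_component_of_refl)
  next
    case 2
    then have "path_component_of (cw_top G) x (vertex v)"
      by (intro path_component_of_closed_edge[OF 2(1)]) (auto simp: closed_edge[OF loop_free[OF 2(1)]])
    then show thesis using that 2 edges_subset by blast
  qed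
qed

text \<open>
  The sum of the barycentric coordinates at the vertices that carry the label of \<open>v\<close> is continuous. As
  the two ends of an edge have equal labels, it takes only the values 0 and 1 on the graph. If the
  labels of \<open>v\<close> and \<open>w\<close> differed, a path between them would give it all values between 0 and 1.
\<close>

lemma path_component_of_vertex_label:
  assumes lab: "\<And>v w. (v, w) \<in> E \<Longrightarrow> l v = l w" and v: "v \<in> V" and w: "w \<in> V"
    and pc: "path_component_of (cw_top G) (vertex v) (vertex w)"
  shows "l v = l w"
proof (rule ccontr)
  assume neq: "l v \<noteq> l w"
  let ?I = "{i \<in> V. l i = l v}"
  define g :: "(nat \<Rightarrow> real) \<Rightarrow> real" where "g x = (\<Sum>i\<in>?I. x i)" for x
  have finI: "finite ?I" using finite_V by simp
  have gv: "g (vertex u) = (if l u = l v then 1 else 0)" if "u \<in> V" for u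
    using finI that by (simp add: g_def vertex_def)
  \<comment> \<open>On an edge, \<open>g\<close> interpolates affinely between its equal values at the two ends.\<close>
  have ge: "g x \<in> {0, 1}" if e: "(a, b) \<in> E" and x: "x \<in> open_edge a b" for a b x
  proof -
    obtain t where t: "x = edge_point a b t" using x by (auto simp: open_edge_def)
    have ab: "a \<noteq> b" "a \<in> V" "b \<in> V" "l a = l b" using e loop_free edges_subset lab by auto
    have "x = (\<lambda>i. (1 - t) * vertex a i + t * vertex b i)"
      using ab t by (auto simp: edge_point_def vertex_def)
    then have "g x = (1 - t) * g (vertex a) + t * g (vertex b)"
      by (simp add: g_def sum.distrib sum_distrib_left)
    then show ?thesis using gv[OF ab(2)] gv[OF ab(3)] ab(4) by auto
  qed
  have g01: "g x \<in> {0, 1}" if x: "x \<in> topspace (cw_top G)" for x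
  proof -
    consider u where "u \<in> V" "x = vertex u" | a b where "(a, b) \<in> E" "x \<in> open_edge a b"
      using x by (auto simp: topspace_graph_cw)
    then show ?thesis by cases (auto simp: gv dest: ge)
  qed
  have cont: "continuous_map (cw_top G) euclideanreal g"
    unfolding g_def cw_top_graph_cw using finI
    by (intro continuous_map_sum continuous_map_from_subtopology continuous_map_product_projection) auto
  obtain C where C: "path_connectedin (cw_top G) C" "vertex v \<in> C" "vertex w \<in> C"
    using pc unfolding path_component_of by blast
  have "connectedin euclideanreal (g ` C)"
    by (rule connectedin_continuous_map_image[OF cont path_connectedin_imp_connectedin[OF C(1)]])
  then have "connected (g ` C)" by simp
  moreover have "1 \<in> g ` C" "0 \<in> g ` C"
    using C(2,3) gv[OF v] gv[OF w] neq by (metis (full_types) image_eqI)+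
  ultimately have "{0..1} \<subseteq> g ` C" by (intro connected_contains_Icc)
  then have "1/2 \<in> g ` C" by (simp add: subset_iff)
  moreover have "C \<subseteq> topspace (cw_top G)" using C(1) path_connectedin_subset_topspace by blast
  ultimately show False using g01 by fastforce
qed

end

section \<open>Realization of component modules\<close>

text \<open>
  The graph \<open>X(q)\<close> records every basis element that lives at some \<open>p \<le> q\<close> as a vertex and glues it along
  edges to its images. In the proof, \<open>joined\<close>, \<open>separated\<close> and \<open>reach\<close> together say that
  \<open>b \<mapsto> (q, b)\<close> is a bijection from \<open>B q\<close> to the path components of \<open>X(q)\<close>.
\<close>

lemma fin_gen_component_module_realization:
  fixes M :: "('p::order, 'k, 'v) pers_module"
  assumes K: "field K" and P: "finite P" and M: "fin_gen_component_module K P M"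
  shows "\<exists>X :: 'p \<Rightarrow> (nat \<Rightarrow> real) cw_data.
    finite_filtered_cw_complex P X \<and> persistence_iso K P M (homology_pers_module K 0 X)"
proof -
  have pm: "persistence_module K P M" using M by (auto simp: fin_gen_component_module_def component_module_def)
  then obtain B where "component_basis K P M B" using M by (auto simp: fin_gen_component_module_def)
  then have basis: "\<And>q. q \<in> P \<Longrightarrow> vectorspace.basis K (pm_obj M q) (B q)"
    and B: "\<And>q p b. q \<in> P \<Longrightarrow> p \<in> P \<Longrightarrow> q \<le> p \<Longrightarrow> b \<in> B q \<Longrightarrow> pm_mor M q p b \<in> B p"
    unfolding component_basis_iff[OF pm] by blast+
  have vs: "vectorspace K (pm_obj M q)" if "q \<in> P" for q
    using pm that by (auto simp: persistence_module_def)
  have lin: "linear_map K (pm_obj M q) (pm_obj M p) (pm_mor M q p)" if "q \<in> P" "p \<in> P" "q \<le> p" for q p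
    using pm that by (auto simp: persistence_module_def)
  have BC: "B q \<subseteq> carrier (pm_obj M q)" and finB: "finite (B q)" if q: "q \<in> P" for q
  proof -
    interpret V: vectorspace K "pm_obj M q" by (rule vs[OF q])
    show "B q \<subseteq> carrier (pm_obj M q)" using basis[OF q] V.basis_subset_carrier by blast
    show "finite (B q)"
      using pm q V.fin_dim_li_fin basis[OF q] by (auto simp: persistence_module_def V.basis_def)
  qed
  have idC: "\<forall>q\<in>P. \<forall>v\<in>carrier (pm_obj M q). pm_mor M q q v = v"
    and compC: "\<forall>q\<in>P. \<forall>p\<in>P. \<forall>r\<in>P. q \<le> p \<longrightarrow> p \<le> r \<longrightarrow>
      (\<forall>v\<in>carrier (pm_obj M q). pm_mor M q r v = pm_mor M p r (pm_mor M q p v))"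
    using pm unfolding persistence_module_def by - (elim conjE, assumption)+
  note idM = idC[rule_format, OF _ subsetD[OF BC]]
  note compM = compC[rule_format, OF _ _ _ _ _ subsetD[OF BC], symmetric]
  let ?N = "Sigma P B"
  have "finite ?N" using P finB by (rule finite_SigmaI)
  \<comment> \<open>Vertices of graphs are natural numbers, so the pairs \<open>(p, b)\<close> have to be numbered.\<close>
  then obtain \<nu> :: "'p \<times> 'v \<Rightarrow> nat" where \<nu>: "inj_on \<nu> ?N"
    using finite_imp_inj_to_nat_seg by metis
  define Vq where "Vq q = \<nu> ` {(p, b). p \<in> P \<and> p \<le> q \<and> b \<in> B p}" for q
  define Eq where "Eq q = {(\<nu> (p, b), \<nu> (r, pm_mor M p r b)) | p r b. p \<in> P \<and> r \<in> P \<and> p < r \<and> r \<le> q \<and> b \<in> B p}" for q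
  define X where "X q = graph_cw (Vq q) (Eq q)" for q
  let ?T = "\<lambda>q. cw_top (X q)"
  have graph: "finite_graph (Vq q) (Eq q)" for q
  proof
    show "finite (Vq q)"
      unfolding Vq_def by (rule finite_imageI, rule finite_subset[OF _ \<open>finite ?N\<close>]) auto
    show "Eq q \<subseteq> Vq q \<times> Vq q"
    proof
      fix e assume "e \<in> Eq q"
      then obtain p r b where e: "e = (\<nu> (p, b), \<nu> (r, pm_mor M p r b))" and h: "p \<in> P" "r \<in> P" "p < r" "r \<le> q" "b \<in> B p"
        unfolding Eq_def by blast
      have "pm_mor M p r b \<in> B r" using B h by simp
      moreover have "p \<le> q" using h by simp
      ultimately show "e \<in> Vq q \<times> Vq q" unfolding e Vq_def using h by blast
    qed
    fix v w assume "(v, w) \<in> Eq q"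
    then obtain p r b where e: "v = \<nu> (p, b)" "w = \<nu> (r, pm_mor M p r b)" and h: "p \<in> P" "r \<in> P" "p < r" "r \<le> q" "b \<in> B p"
      unfolding Eq_def by blast
    have "pm_mor M p r b \<in> B r" using B h by simp
    then show "v \<noteq> w" using inj_onD[OF \<nu>, of "(p, b)" "(r, pm_mor M p r b)"] e h by auto
  qed
  have filt: "finite_filtered_cw_complex P X"
    unfolding finite_filtered_cw_complex_def filtered_cw_complex_def
  proof (intro conjI ballI impI)
    fix q p :: 'p assume qp: "q \<le> p"
    show "cw_subcomplex (X q) (X p)" unfolding X_def
    proof (rule finite_graph.cw_subcomplex_graph[OF graph])
      show "Vq q \<subseteq> Vq p" unfolding Vq_def using qp by (auto intro: order_trans)
      show "Eq q \<subseteq> Eq p" unfolding Eq_def using qp order_trans by blast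
      show "Eq q \<subseteq> Vq q \<times> Vq q" by (rule finite_graph.edges_subset[OF graph])
    qed
  qed (auto simp: X_def finite_graph.finite_cw_complex_graph[OF graph] finite_graph.finite_cw_complex_graph[OF graph, unfolded finite_cw_complex_def])
  define vx where "vx p b = vertex (\<nu> (p, b))" for p b
  have vx_in: "vx p b \<in> topspace (?T q)" if "p \<in> P" "p \<le> q" "b \<in> B p" for p q b
    using that unfolding X_def topspace_graph_cw vx_def Vq_def by blast
  have joined: "path_component_of (?T q) (vx p b) (vx q (pm_mor M p q b))"
    if "p \<in> P" "q \<in> P" "p \<le> q" "b \<in> B p" for p q b
  proof (cases "p = q")
    case True
    then show ?thesis using that idM vx_in by (simp add: path_component_of_refl)
  next
    case False
    then have "(\<nu> (p, b), \<nu> (q, pm_mor M p q b)) \<in> Eq q" unfolding Eq_def using that by fastforce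
    then show ?thesis unfolding vx_def X_def by (rule finite_graph.path_component_of_edge[OF graph])
  qed
  have separated: "b = b'" if q: "q \<in> P" and b: "b \<in> B q" "b' \<in> B q" and pc: "path_component_of (?T q) (vx q b) (vx q b')" for q b b'
  proof -
    \<comment> \<open>The label of \<open>(p, c)\<close> is the basis element at \<open>q\<close> that \<open>c\<close> is sent to.\<close>
    define l where "l v = (case inv_into ?N \<nu> v of (p, c) \<Rightarrow> pm_mor M p q c)" for v
    have l: "l (\<nu> (p, c)) = pm_mor M p q c" if "p \<in> P" "c \<in> B p" for p c
      using inv_into_f_f[OF \<nu>, of "(p, c)"] that by (simp add: l_def)
    have "l (\<nu> (q, b)) = l (\<nu> (q, b'))"
    proof (rule finite_graph.path_component_of_vertex_label[OF graph _ _ _ pc[unfolded vx_def X_def]])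
      show "\<nu> (q, b) \<in> Vq q" "\<nu> (q, b') \<in> Vq q" using q b by (auto simp: Vq_def)
      fix v w assume "(v, w) \<in> Eq q"
      then obtain p r c where e: "v = \<nu> (p, c)" "w = \<nu> (r, pm_mor M p r c)" and h: "p \<in> P" "r \<in> P" "p < r" "r \<le> q" "c \<in> B p"
        unfolding Eq_def by blast
      have "pm_mor M p r c \<in> B r" using B h by simp
      then show "l v = l w" using e h l compM[of p r q c] q by auto
    qed
    then show ?thesis using l idM q b by simp
  qed
  have reach: "\<exists>b\<in>B q. path_component_of (?T q) x (vx q b)" if q: "q \<in> P" and x: "x \<in> topspace (?T q)" for q x
  proof -
    obtain v where v: "v \<in> Vq q" "path_component_of (?T q) x (vertex v)"
      using finite_graph.path_component_of_some_vertex[OF graph x[unfolded X_def]] unfolding X_def by blast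
    obtain p b where pb: "v = \<nu> (p, b)" "p \<in> P" "p \<le> q" "b \<in> B p" using v(1) unfolding Vq_def by blast
    have "path_component_of (?T q) x (vx q (pm_mor M p q b))"
      using v(2) joined[OF pb(2) q pb(3,4)] path_component_of_trans unfolding pb(1) vx_def[symmetric] by metis
    then show ?thesis using B pb q by blast
  qed
  define \<sigma> where "\<sigma> q b = point_class K (?T q) (vx q b)" for q b
  let ?C = "\<lambda>q. point_class K (?T q) ` topspace (?T q)"
  have bij: "bij_betw (\<sigma> q) (B q) (?C q)" if q: "q \<in> P" for q
  proof (rule bij_betw_imageI)
    have vxq: "vx q b \<in> topspace (?T q)" if "b \<in> B q" for b using vx_in q that by simp
    show "inj_on (\<sigma> q) (B q)"
      unfolding \<sigma>_def by (rule inj_onI) (use separated[OF q] point_class_eq_iff[OF K vxq vxq] in blast)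
    show "\<sigma> q ` B q = ?C q"
    proof
      show "\<sigma> q ` B q \<subseteq> ?C q" using vxq by (auto simp: \<sigma>_def)
      show "?C q \<subseteq> \<sigma> q ` B q"
      proof (rule image_subsetI)
        fix x assume x: "x \<in> topspace (?T q)"
        then obtain b where b: "b \<in> B q" "path_component_of (?T q) x (vx q b)" using reach[OF q x] by blast
        then have "point_class K (?T q) x = \<sigma> q b" using point_class_eq_iff[OF K x vxq] by (simp add: \<sigma>_def)
        then show "point_class K (?T q) x \<in> \<sigma> q ` B q" using b by blast
      qed
    qed
  qed
  have "\<exists>\<phi>. linear_map K (pm_obj M q) (K_homology K 0 (?T q)) \<phi> \<and>
     bij_betw \<phi> (carrier (pm_obj M q)) (carrier (K_homology K 0 (?T q))) \<and> (\<forall>b\<in>B q. \<phi> b = \<sigma> q b)" if q: "q \<in> P" for q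
  proof -
    have finC: "finite (?C q)" using bij[OF q] finB[OF q] bij_betw_finite by blast
    show ?thesis
      using linear_bij_extension[OF vs[OF q] vectorspace_K_homology_0[OF K] finB[OF q] basis[OF q] basis_point_class[OF K finC] bij[OF q]]
      by metis
  qed
  then obtain \<phi> where \<phi>: "\<And>q. q \<in> P \<Longrightarrow> linear_map K (pm_obj M q) (K_homology K 0 (?T q)) (\<phi> q)"
     "\<And>q. q \<in> P \<Longrightarrow> bij_betw (\<phi> q) (carrier (pm_obj M q)) (carrier (K_homology K 0 (?T q)))"
     "\<And>q b. q \<in> P \<Longrightarrow> b \<in> B q \<Longrightarrow> \<phi> q b = \<sigma> q b"
    by metis
  have natural: "\<phi> p (pm_mor M q p v) = K_hom_induced K 0 (?T p) (\<lambda>x. x) (\<phi> q v)"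
    if qp: "q \<in> P" "p \<in> P" "q \<le> p" and v: "v \<in> carrier (pm_obj M q)" for q p v
  proof -
    obtain S where S: "?T q = subtopology (?T p) S"
      using filt qp unfolding finite_filtered_cw_complex_def filtered_cw_complex_def cw_subcomplex_def by blast
    show ?thesis
    proof (rule linear_maps_eq_on_basis[OF linear_map_comp[OF lin[OF qp] \<phi>(1)[OF qp(2)]]
          linear_map_comp[OF \<phi>(1)[OF qp(1)] linear_map_K_hom_induced[OF K S]] finB[OF qp(1)] basis[OF qp(1)] _ v])
      fix b assume b: "b \<in> B q"
      have Mb: "pm_mor M q p b \<in> B p" using B qp b by simp
      have "\<phi> p (pm_mor M q p b) = point_class K (?T p) (vx p (pm_mor M q p b))"
        using \<phi>(3) qp Mb by (simp add: \<sigma>_def)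
      also have "\<dots> = point_class K (?T p) (vx q b)"
        using joined[OF qp b] point_class_eq_iff[OF K] vx_in qp b Mb by (metis order_refl)
      also have "\<dots> = K_hom_induced K 0 (?T p) (\<lambda>x. x) (\<phi> q b)"
        using K_hom_induced_point_class[OF K S vx_in] \<phi>(3) qp b by (simp add: \<sigma>_def)
      finally show "\<phi> p (pm_mor M q p b) = K_hom_induced K 0 (?T p) (\<lambda>x. x) (\<phi> q b)" .
    qed
  qed
  have "persistence_iso K P M (homology_pers_module K 0 X)"
    unfolding persistence_iso_def homology_pers_module_def pers_module.simps
    using \<phi>(1,2) natural by blast
  then show ?thesis using filt by blast
qed

theorem theorem4p4:
  fixes K :: "('k, 'm) ring_scheme" and P :: "'p::order set"
  assumes "field K" and "finite P"
  shows "(\<forall>X :: 'p \<Rightarrow> 'a cw_data.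
            finite_filtered_cw_complex P X \<longrightarrow>
            fin_gen_component_module K P (homology_pers_module K 0 X)) \<and>
         (\<forall>M :: ('p, 'k, 'v) pers_module.
            fin_gen_component_module K P M \<longrightarrow>
            (\<exists>X :: 'p \<Rightarrow> (nat \<Rightarrow> real) cw_data.
               finite_filtered_cw_complex P X \<and>
               persistence_iso K P M (homology_pers_module K 0 X)))"
proof (intro conjI allI impI)
  fix X :: "'p \<Rightarrow> 'a cw_data"
  assume "finite_filtered_cw_complex P X"
  then show "fin_gen_component_module K P (homology_pers_module K 0 X)"
    by (rule homology_0_fin_gen_component_module[OF \<open>field K\<close> _ \<open>finite P\<close>])
next
  fix M :: "('p, 'k, 'v) pers_module"
  assume "fin_gen_component_module K P M"
  then show "\<exists>X :: 'p \<Rightarrow> (nat \<Rightarrow> real) cw_data.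
      finite_filtered_cw_complex P X \<and> persistence_iso K P M (homology_pers_module K 0 X)"
    by (rule fin_gen_component_module_realization[OF \<open>field K\<close> \<open>finite P\<close>])
qed

end
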